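(* Let $n\ge k\ge1$ be integers. For each choice of $\mathrm{MAG}\in\{\mathrm{MAK},\mathrm{MAK}'\}$, $$\sum_{\pi\in\mathcal{OP}_n^k}p^{(\mathrm{MAG}+\mathrm{bMaj})\,\pi}\,q^{\mathrm{cmajLSB}\,\pi}=q^{\binom k2}\,[k]_{p,q}!\,S_{p,q}(n,k).$$ In particular, the three statistics $\mathrm{MAK}+\mathrm{bMaj}$, $\mathrm{MAK}'+\mathrm{bMaj}$ and $\mathrm{cmajLSB}$ are Euler-Mahonian on $\mathcal{OP}_n^k$.
   Context: $[n]=\{1,\dots,n\}$. An ordered partition of $[n]$ into $k$ blocks is a sequence $\pi=B_1/B_2/\cdots/B_k$ of disjoint nonempty subsets (blocks) of $[n]$ whose union is $[n]$; $\mathcal{OP}_n^k$ is the set of all of them. The opener (resp. closer) of a block is its least (resp. greatest) element; $\mathrm{open}(\pi)$ and $\mathrm{clos}(\pi)$ are the sets of openers and closers of the blocks of $\pi$. For $i\in[n]$ let $w_i$ be the index (position, counted from left to right) of the block of $\pi$ containing $i$. Define $\mathrm{ros}(\pi)=\sum_{i=1}^n\#\{j\in\mathrm{open}(\pi): j<i,\ w_j>w_i\}$, $\mathrm{lcs}(\pi)=\sum_{i=1}^n\#\{j\in\mathrm{clos}(\pi): j<i,\ w_j<w_i\}$, $\mathrm{lob}(\pi)=\sum_{i=1}^n\#\{j\in\mathrm{open}(\pi): j>i,\ w_j<w_i\}$, $\mathrm{rcb}(\pi)=\sum_{i=1}^n\#\{j\in\mathrm{clos}(\pi): j>i,\ w_j>w_i\}$,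 and $\mathrm{lsb}(\pi)=\sum_{i=1}^n\mathrm{lsb}_i(\pi)$, where $\mathrm{lsb}_i(\pi)$ is the number of blocks to the left of the block containing $i$ whose opener is smaller than $i$ and whose closer is greater than $i$. Put $\mathrm{MAK}=\mathrm{ros}+\mathrm{lcs}$ and $\mathrm{MAK}'=\mathrm{lob}+\mathrm{rcb}$. For $\pi=B_1/\cdots/B_k$ write $B_i\succ B_j$ if $\min B_i>\max B_j$. A block descent is an integer $i$ with $B_i\succ B_{i+1}$, and $\mathrm{bMaj}(\pi)$ is the sum of the block descents of $\pi$. Put $\mathrm{cbMaj}=\binom k2-\mathrm{bMaj}$ and $\mathrm{cmajLSB}=\mathrm{lsb}+\mathrm{cbMaj}+\binom k2$. The $p,q$-Stirling numbers are defined by $S_{p,q}(n,k)=p^{k-1}S_{p,q}(n-1,k-1)+[k]_{p,q}S_{p,q}(n-1,k)$ if $0<k\le n$, $S_{p,q}(0,0)=1$, and $S_{p,q}(n,k)=0$ otherwise, where $[k]_{p,q}=p^{k-1}+p^{k-2}q+\cdots+pq^{k-2}+q^{k-1}$; $[k]_{p,q}!=[1]_{p,q}[2]_{p,q}\cdots[k]_{p,q}$. Also $S_q(n,k)=S_{q,1}(n,k)$, $[m]_q=1+q+\cdots+q^{m-1}$ and $[k]_q!=[1]_q[2]_q\cdots[k]_q$. A statistic $\mathrm{STAT}$ is Euler-Mahonian on $\mathcal{OP}_n^k$ if $\sum_{\pi\in\mathcal{OP}_n^k}q^{\mathrm{STAT}\,\pi}=[k]_q!\,S_q(n,k)$. 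*)

theory Defs
  imports Complex_Main "HOL-Library.Disjoint_Sets" "HOL-Computational_Algebra.Polynomial"
begin

definition ordered_partitions :: "nat \<Rightarrow> nat \<Rightarrow> nat set list set" where
  "ordered_partitions n k =
     {\<pi>. length \<pi> = k \<and> {} \<notin> set \<pi> \<and>
          disjoint_family_on (\<lambda>i. \<pi> ! i) {..<k} \<and> \<Union> (set \<pi>) = {1..n}}"

definition openers :: "nat set list \<Rightarrow> nat set" where
  "openers \<pi> = Min ` set \<pi>"

definition closers :: "nat set list \<Rightarrow> nat set" where
  "closers \<pi> = Max ` set \<pi>"

text \<open>The position of the block containing \<open>i\<close>, counted from 0.  The statistics below only
  compare positions, so the offset does not matter there.  They sum over \<open>\<Union> (set \<pi>)\<close>, which
  is \<open>{1..n}\<close> for every ordered partition of \<open>{1..n}\<close>.\<close>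

definition block_index :: "nat set list \<Rightarrow> nat \<Rightarrow> nat" where
  "block_index \<pi> i = (THE w. w < length \<pi> \<and> i \<in> \<pi> ! w)"

definition ros :: "nat set list \<Rightarrow> nat" where
  "ros \<pi> = (\<Sum>i\<in>\<Union> (set \<pi>).
     card {j \<in> openers \<pi>. j < i \<and> block_index \<pi> j > block_index \<pi> i})"

definition lcs :: "nat set list \<Rightarrow> nat" where
  "lcs \<pi> = (\<Sum>i\<in>\<Union> (set \<pi>).
     card {j \<in> closers \<pi>. j < i \<and> block_index \<pi> j < block_index \<pi> i})"

definition lob :: "nat set list \<Rightarrow> nat" where
  "lob \<pi> = (\<Sum>i\<in>\<Union> (set \<pi>).
     card {j \<in> openers \<pi>. j > i \<and> block_index \<pi> j < block_index \<pi> i})"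

definition rcb :: "nat set list \<Rightarrow> nat" where
  "rcb \<pi> = (\<Sum>i\<in>\<Union> (set \<pi>).
     card {j \<in> closers \<pi>. j > i \<and> block_index \<pi> j > block_index \<pi> i})"

definition lsb_at :: "nat set list \<Rightarrow> nat \<Rightarrow> nat" where
  "lsb_at \<pi> i = card {b. b < block_index \<pi> i \<and> Min (\<pi> ! b) < i \<and> Max (\<pi> ! b) > i}"

definition lsb :: "nat set list \<Rightarrow> nat" where
  "lsb \<pi> = (\<Sum>i\<in>\<Union> (set \<pi>). lsb_at \<pi> i)"

definition MAK :: "nat set list \<Rightarrow> nat" where
  "MAK \<pi> = ros \<pi> + lcs \<pi>"

definition MAK' :: "nat set list \<Rightarrow> nat" where
  "MAK' \<pi> = lob \<pi> + rcb \<pi>"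

definition block_gt :: "nat set \<Rightarrow> nat set \<Rightarrow> bool" where
  "block_gt A B \<longleftrightarrow> Min A > Max B"

text \<open>Block descents are numbered from 1: the block \<open>B\<^sub>i\<close> is \<open>\<pi> ! (i - 1)\<close>.\<close>

definition block_descents :: "nat set list \<Rightarrow> nat set" where
  "block_descents \<pi> = {i. 1 \<le> i \<and> i < length \<pi> \<and> block_gt (\<pi> ! (i - 1)) (\<pi> ! i)}"

definition bMaj :: "nat set list \<Rightarrow> nat" where
  "bMaj \<pi> = \<Sum> (block_descents \<pi>)"

text \<open>The subtraction never truncates: the block descents lie in \<open>{1..<k}\<close>, so their sum is at
  most \<open>k choose 2\<close>.\<close>

definition cbMaj :: "nat set list \<Rightarrow> nat" where
  "cbMaj \<pi> = (length \<pi> choose 2) - bMaj \<pi>"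

definition cmajLSB :: "nat set list \<Rightarrow> nat" where
  "cmajLSB \<pi> = lsb \<pi> + cbMaj \<pi> + (length \<pi> choose 2)"

definition pq_bracket :: "'a::comm_semiring_1 \<Rightarrow> 'a \<Rightarrow> nat \<Rightarrow> 'a" where
  "pq_bracket p q k = (\<Sum>i<k. p ^ (k - 1 - i) * q ^ i)"

definition pq_fact :: "'a::comm_semiring_1 \<Rightarrow> 'a \<Rightarrow> nat \<Rightarrow> 'a" where
  "pq_fact p q k = (\<Prod>i=1..k. pq_bracket p q i)"

fun pq_Stirling :: "'a::comm_semiring_1 \<Rightarrow> 'a \<Rightarrow> nat \<Rightarrow> nat \<Rightarrow> 'a" where
  "pq_Stirling p q 0 0 = 1"
| "pq_Stirling p q 0 (Suc k) = 0"
| "pq_Stirling p q (Suc n) 0 = 0"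
| "pq_Stirling p q (Suc n) (Suc k) =
     (if Suc k \<le> Suc n
      then p ^ k * pq_Stirling p q n k + pq_bracket p q (Suc k) * pq_Stirling p q n (Suc k)
      else 0)"

definition q_Stirling :: "'a::comm_semiring_1 \<Rightarrow> nat \<Rightarrow> nat \<Rightarrow> 'a" where
  "q_Stirling q n k = pq_Stirling q 1 n k"

definition q_bracket :: "'a::comm_semiring_1 \<Rightarrow> nat \<Rightarrow> 'a" where
  "q_bracket q m = (\<Sum>i<m. q ^ i)"

definition q_fact :: "'a::comm_semiring_1 \<Rightarrow> nat \<Rightarrow> 'a" where
  "q_fact q k = (\<Prod>i=1..k. q_bracket q i)"

text \<open>An identity in the polynomial ring over the integers, with \<open>q\<close> the indeterminate
  \<open>[:0, 1:]\<close>.\<close>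

definition Euler_Mahonian :: "nat \<Rightarrow> nat \<Rightarrow> (nat set list \<Rightarrow> nat) \<Rightarrow> bool" where
  "Euler_Mahonian n k stat \<longleftrightarrow>
     (let q = [:0, 1:] :: int poly
      in (\<Sum>\<pi>\<in>ordered_partitions n k. q ^ stat \<pi>) = q_fact q k * q_Stirling q n k)"

end

theory Submission
  imports Defs
begin

text \<open>
  An ordered partition of \<open>{1..n}\<close> is built by adjoining \<open>1, 2, \<dots>, n\<close> one after the other.  At
  each stage a block is active if it still has to receive larger elements.  Suppose that there are \<open>j\<close>
  blocks, \<open>a\<close> of them active.  Whatever the new element does, it meets every other block exactly once
  in \<open>ros\<close>, \<open>lcs\<close> or \<open>lsb\<close>: a block to its right in \<open>ros\<close>, a complete block to its left
  in \<open>lcs\<close>, an active block to its left in \<open>lsb\<close>.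

  If the new element joins an active block, then \<open>bMaj\<close> does not change, and the sum over the active
  blocks of the weights \<open>p ^ MAK * q ^ lsb\<close> of the new element is \<open>p ^ (j - a) * [a]\<close>.  If it opens
  a block, there are \<open>j + 1\<close> slots.  A variant of the classical insertion argument for the major index
  (\<open>descent_insertion\<close>) shows that the increment of \<open>bMaj\<close> minus the number of active blocks to
  the left of the slot takes the values \<open>-a, \<dots>, j - a\<close>, each once.  Since \<open>j choose 2\<close> grows by
  \<open>j\<close>, the weights \<open>p ^ (MAK + bMaj) * q ^ (lsb + (j choose 2) - bMaj)\<close> gain the factor
  \<open>p ^ (j - a) * q ^ a * [j + 1]\<close> in total.  Thus the weights depend on the numbers \<open>j\<close> and \<open>a\<close> only.

  It remains to sum over the choices of which blocks are active.  By induction on \<open>n\<close>, the total weight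
  of the partitions of \<open>{1..n}\<close> with \<open>j\<close> blocks, \<open>a\<close> of them active, is \<open>[j]!\<close> times a
  Stirling number times \<open>p ^ ((j - a) choose 2) * q ^ (a choose 2)\<close> times a \<open>p,q\<close>-binomial
  coefficient.  Summation against these coefficients is the functional \<open>marking_sum\<close>, and its property
  \<open>marking_sum_extend\<close> carries the induction step in \<open>sum_weight_marked_partitions\<close>.  The case
  \<open>a = 0\<close> is the claim for \<open>MAK\<close>.

  The involution \<open>i \<mapsto> n + 1 - i\<close> turns \<open>MAK'\<close> into \<open>MAK\<close> and fixes \<open>lsb\<close>, but turns block
  descents into block ascents.  These satisfy the same insertion property (\<open>ascent_insertion\<close>), so the
  argument applies again.  The Euler-Mahonian statements are the specializations \<open>q = 1\<close> and
  \<open>p = 1\<close>.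
\<close>

section \<open>Brackets and Stirling numbers\<close>

lemma pq_bracket_0 [simp]: "pq_bracket p q 0 = 0"
  by (simp add: pq_bracket_def)

lemma pq_bracket_Suc: "pq_bracket p q (Suc a) = p ^ a + q * pq_bracket p q a"
  by (simp add: pq_bracket_def sum.lessThan_Suc_shift sum_distrib_left algebra_simps del: sum.lessThan_Suc)

lemma pq_bracket_commute: "pq_bracket p q a = pq_bracket q p a"
  unfolding pq_bracket_def
  by (subst sum.nat_diff_reindex[symmetric]) (auto intro!: sum.cong simp: mult.commute)

lemma pq_bracket_atMost: "pq_bracket p q (Suc j) = (\<Sum>e\<le>j. p ^ e * q ^ (j - e))"
  by (subst pq_bracket_commute)
     (auto simp: pq_bracket_def lessThan_Suc_atMost mult.commute intro!: sum.cong)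

lemma pq_bracket_one_right: "pq_bracket q 1 m = q_bracket q m"
  by (subst pq_bracket_commute) (simp add: pq_bracket_def q_bracket_def)

lemma pq_fact_commute: "pq_fact p q k = pq_fact q p k"
  by (simp add: pq_fact_def pq_bracket_commute[of p])

lemma pq_fact_one_right: "pq_fact q 1 k = q_fact q k"
  by (simp add: pq_fact_def q_fact_def pq_bracket_one_right)

lemma pq_fact_Suc: "pq_fact p q (Suc j) = pq_bracket p q (Suc j) * pq_fact p q j"
  by (simp add: pq_fact_def mult.commute)

text \<open>The \<open>p,q\<close>-Stirling number without its factor \<open>p ^ (k choose 2)\<close>.  Unlike
  \<open>pq_Stirling\<close> it is symmetric in \<open>p\<close> and \<open>q\<close>.\<close>

fun red_Stirling :: "'a::comm_semiring_1 \<Rightarrow> 'a \<Rightarrow> nat \<Rightarrow> nat \<Rightarrow> 'a" where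
  "red_Stirling p q 0 0 = 1"
| "red_Stirling p q 0 (Suc k) = 0"
| "red_Stirling p q (Suc n) 0 = 0"
| "red_Stirling p q (Suc n) (Suc k) =
     red_Stirling p q n k + pq_bracket p q (Suc k) * red_Stirling p q n (Suc k)"

lemma red_Stirling_eq_0: "n < k \<Longrightarrow> red_Stirling p q n k = 0"
  by (induction n arbitrary: k; case_tac k) auto

lemma choose_2_Suc: "Suc j choose 2 = (j choose 2) + j"
  by (simp add: numeral_2_eq_2)

lemma pq_Stirling_red: "pq_Stirling p q n k = p ^ (k choose 2) * red_Stirling p q n k"
proof (induction n arbitrary: k)
  case 0
  show ?case by (cases k) (auto simp: numeral_2_eq_2)
next
  case (Suc n)
  show ?case
  proof (cases k)
    case 0
    then show ?thesis by (simp add: numeral_2_eq_2)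
  next
    case (Suc k')
    then show ?thesis
      by (auto simp: Suc.IH red_Stirling_eq_0 choose_2_Suc power_add algebra_simps)
  qed
qed

lemma red_Stirling_commute: "red_Stirling p q n k = red_Stirling q p n k"
  by (induction p q n k rule: red_Stirling.induct) (auto simp: pq_bracket_commute)

section \<open>Summation over markings\<close>

text \<open>The linear functional \<open>\<Sum>a\<le>j. p ^ ((j - a) choose 2) * q ^ (a choose 2) * C(j, a) * \<phi> a\<close>,
  where \<open>C(j, a)\<close> is the \<open>p,q\<close>-binomial coefficient: it accounts for choosing which \<open>a\<close> of
  \<open>j\<close> blocks are active.  The recursion is the \<open>p,q\<close>-Pascal rule, which makes it unnecessary to
  introduce the coefficients themselves.\<close>

fun marking_sum :: "'a::comm_semiring_1 \<Rightarrow> 'a \<Rightarrow> nat \<Rightarrow> (nat \<Rightarrow> 'a) \<Rightarrow> 'a" where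
  "marking_sum p q 0 \<phi> = \<phi> 0"
| "marking_sum p q (Suc j) \<phi> =
     marking_sum p q j (\<lambda>a. p ^ (j - a) * q ^ a * (\<phi> (Suc a) + \<phi> a))"

lemma marking_sum_cong:
  "(\<And>a. a \<le> j \<Longrightarrow> \<phi> a = \<psi> a) \<Longrightarrow> marking_sum p q j \<phi> = marking_sum p q j \<psi>"
proof (induction j arbitrary: \<phi> \<psi>)
  case (Suc j)
  show ?case unfolding marking_sum.simps
    by (rule Suc.IH) (simp add: Suc.prems)
qed simp

lemma marking_sum_add:
  "marking_sum p q j (\<lambda>a. \<phi> a + \<psi> a) = marking_sum p q j \<phi> + marking_sum p q j \<psi>"
proof (induction j arbitrary: \<phi> \<psi>)
  case (Suc j)
  show ?case unfolding marking_sum.simps Suc.IH[symmetric]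
    by (rule marking_sum_cong) (simp add: algebra_simps)
qed simp

lemma marking_sum_scale:
  "marking_sum p q j (\<lambda>a. c * \<phi> a) = c * marking_sum p q j \<phi>"
proof (induction j arbitrary: \<phi>)
  case (Suc j)
  show ?case unfolding marking_sum.simps Suc.IH[symmetric]
    by (rule marking_sum_cong) (simp add: algebra_simps)
qed simp

text \<open>Write \<open>T\<^sub>j\<close> for the operator in the recursion of \<open>marking_sum\<close> and
  \<open>(U\<^sub>j \<phi>) a = p ^ (j - a) * [a] * (\<phi> a + \<phi> (a - 1))\<close> for the one below, which describes the
  addition of a new element to one of the active blocks.  The lemma says that the functional is a left
  eigenvector of \<open>U\<^sub>j\<close> with eigenvalue \<open>[j]\<close>.  It follows by induction from the
  commutation rule \<open>T\<^sub>j U\<^bsub>j+1\<^esub> = q U\<^sub>j T\<^sub>j + p ^ j T\<^sub>j\<close> and \<open>[j + 1] = q [j] + p ^ j\<close>.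
  For \<open>a = 0\<close> the truncated \<open>a - 1\<close> is harmless, since \<open>[0] = 0\<close>.\<close>

lemma marking_sum_extend:
  "marking_sum p q j (\<lambda>a. p ^ (j - a) * pq_bracket p q a * (\<phi> a + \<phi> (a - 1)))
     = pq_bracket p q j * marking_sum p q j \<phi>"
proof (induction j arbitrary: \<phi>)
  case (Suc j)
  define T where "T = (\<lambda>a. p ^ (j - a) * q ^ a * (\<phi> (Suc a) + \<phi> a))"
  define U where "U = (\<lambda>b. p ^ (Suc j - b) * pq_bracket p q b * (\<phi> b + \<phi> (b - 1)))"
  \<comment> \<open>the commutation rule at \<open>a\<close>\<close>
  have "p ^ (j - a) * q ^ a * (U (Suc a) + U a)
      = q * (p ^ (j - a) * pq_bracket p q a * (T a + T (a - 1))) + p ^ j * T a"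
    if aj: "a \<le> j" for a
  proof (cases a)
    case 0
    then show ?thesis by (simp add: U_def T_def pq_bracket_Suc algebra_simps)
  next
    case (Suc b)
    obtain d where d: "j = Suc b + d" using le_Suc_ex[of "Suc b" j] aj Suc by blast
    define x y z where "x = \<phi> (Suc a)" and "y = \<phi> a" and "z = \<phi> b"
    define B where "B = pq_bracket p q a"
    have exps: "j - a = d" "j - b = Suc d" "a - 1 = b" "Suc a - 1 = a" "Suc b = a"
      "Suc j - a = Suc d" "Suc j - Suc a = d"
      using d Suc by linarith+
    have U: "U (Suc a) = p ^ d * (p ^ a + q * B) * (x + y)" "U a = p ^ Suc d * B * (y + z)"
      and T: "T a = p ^ d * q ^ a * (x + y)" "T (a - 1) = p ^ Suc d * q ^ b * (y + z)"
      unfolding U_def T_def exps x_def y_def z_def B_def pq_bracket_Suc by (rule refl)+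
    have pj: "p ^ j = p ^ a * p ^ d" and qa: "q ^ a = q * q ^ b"
      unfolding d Suc by (simp_all add: power_add mult.commute mult.left_commute)
    show ?thesis
      unfolding exps(1) U T pj B_def[symmetric] qa by (simp add: algebra_simps)
  qed
  then have "marking_sum p q (Suc j) U =
      marking_sum p q j (\<lambda>a. q * (p ^ (j - a) * pq_bracket p q a * (T a + T (a - 1))) + p ^ j * T a)"
    unfolding marking_sum.simps by (intro marking_sum_cong) simp
  also have "\<dots> = (q * pq_bracket p q j + p ^ j) * marking_sum p q j T"
    by (simp only: marking_sum_add marking_sum_scale Suc.IH) (simp add: algebra_simps)
  finally show ?case
    by (simp add: U_def T_def pq_bracket_Suc add.commute)
qed simp

lemma marking_sum_indicator_0:
  "marking_sum p q j (\<lambda>a. if a = 0 then 1 else 0) = p ^ (j choose 2)"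
proof (induction j)
  case (Suc j)
  have "marking_sum p q (Suc j) (\<lambda>a. if a = 0 then 1 else 0)
      = marking_sum p q j (\<lambda>a. p ^ j * (if a = 0 then 1 else 0))"
    unfolding marking_sum.simps by (rule marking_sum_cong) auto
  then show ?case
    unfolding marking_sum_scale Suc choose_2_Suc by (simp add: power_add mult.commute)
qed (simp add: numeral_2_eq_2)

section \<open>Major index of a relation and insertion into a list\<close>

text \<open>Here \<open>g s\<close> is the number of slots \<open>t > s\<close> with \<open>P t\<close>, given through its recursion.
  The slots with \<open>P\<close> receive, from right to left, the labels \<open>0, 1, 2, \<dots>\<close>; the others
  receive the remaining labels from left to right, because \<open>s + g s\<close> is the number of slots with
  \<open>P\<close> plus the number of slots \<open>t < s\<close> without \<open>P\<close>.\<close>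

lemma slot_label_bij:
  fixes g :: "nat \<Rightarrow> nat"
  assumes step: "\<And>s. s < j \<Longrightarrow> g s = g (Suc s) + (if P (Suc s) then 1 else 0)"
    and last: "g j = 0"
  shows "bij_betw (\<lambda>s. if P s then g s else s + g s) {..j} {..j}"
proof -
  have g_mono: "g t + (if P t then 1 else 0) \<le> g s" if "s < t" "t \<le> j" for s t
    using Suc_leI[OF \<open>s < t\<close>] \<open>t \<le> j\<close>
  proof (induction t rule: dec_induct)
    case (step t)
    then show ?case using assms(1)[of t] by (auto split: if_splits)
  qed (use assms(1)[of s] in auto)
  have g_diff: "g s + s + (if P t then 0 else 1) \<le> g t + t" if "s < t" "t \<le> j" for s t
    using Suc_leI[OF \<open>s < t\<close>] \<open>t \<le> j\<close>
  proof (induction t rule: dec_induct)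
    case (step t)
    then show ?case using assms(1)[of t] by (auto split: if_splits)
  qed (use assms(1)[of s] in auto)
  have strict: "g 0 < s + g s" if "s \<le> j" "\<not> P s" "0 < s" for s
    using g_diff[of 0 s] that by auto
  \<comment> \<open>every label of a slot with \<open>P\<close> is below every label of a slot without \<open>P\<close>\<close>
  have sep: "g s < t + g t" if "P s" "\<not> P t" "s \<le> j" "t \<le> j" for s t
  proof (cases "t = 0")
    case True
    then show ?thesis using g_mono[of 0 s] that by (cases "s = 0") auto
  next
    case False
    then show ?thesis using strict[of t] g_mono[of 0 s] that by (cases "s = 0") auto
  qed
  have "inj_on (\<lambda>s. if P s then g s else s + g s) {..j}"
  proof (rule linorder_inj_onI)
    fix s t assume "s < t" "s \<in> {..j}" "t \<in> {..j}"
    then show "(if P s then g s else s + g s) \<noteq> (if P t then g t else t + g t)"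
      using g_mono[of s t] g_diff[of s t] sep[of s t] sep[of t s] by auto
  qed auto
  moreover have "(\<lambda>s. if P s then g s else s + g s) ` {..j} \<subseteq> {..j}"
  proof -
    have "s + g s \<le> j" if "s \<le> j" for s
      using g_diff[of s j] last that by (cases "s = j") (auto split: if_splits)
    then show ?thesis by fastforce
  qed
  ultimately show ?thesis
    unfolding bij_betw_def using endo_inj_surj[OF finite_atMost] by blast
qed

text \<open>The number of adjacent pairs of a list that are related by \<open>R\<close>, and the sum of their
  positions when the first entry of the list has position \<open>s\<close>.\<close>

fun rel_des :: "('b \<Rightarrow> 'b \<Rightarrow> bool) \<Rightarrow> 'b list \<Rightarrow> nat" where
  "rel_des R (x # y # l) = (if R x y then 1 else 0) + rel_des R (y # l)"
| "rel_des R _ = 0"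

fun rel_maj :: "('b \<Rightarrow> 'b \<Rightarrow> bool) \<Rightarrow> nat \<Rightarrow> 'b list \<Rightarrow> nat" where
  "rel_maj R s (x # y # l) = (if R x y then s else 0) + rel_maj R (Suc s) (y # l)"
| "rel_maj R s _ = 0"

lemma rel_maj_Suc: "rel_maj R (Suc s) l = rel_maj R s l + rel_des R l"
  by (induction R s l rule: rel_maj.induct) auto

lemma rel_maj_append:
  "rel_maj R s (xs @ ys) = rel_maj R s xs + rel_maj R (s + length xs) ys
     + (if xs \<noteq> [] \<and> ys \<noteq> [] \<and> R (last xs) (hd ys) then s + length xs - 1 else 0)"
proof (induction R s xs rule: rel_maj.induct)
  case ("2_2" R s x)
  then show ?case by (cases ys) auto
qed auto

lemma rel_maj_le: "rel_maj R (Suc 0) l \<le> length l choose 2"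
proof (induction l rule: rev_induct)
  case (snoc x l)
  then show ?case by (auto simp: rel_maj_append choose_2_Suc)
qed simp

lemma rel_maj_nth:
  "rel_maj R s l = (\<Sum>i | Suc i < length l \<and> R (l ! i) (l ! Suc i). s + i)"
proof (induction R s l rule: rel_maj.induct)
  case (1 R s x y l)
  let ?A = "{i. Suc i < length (y # l) \<and> R ((y # l) ! i) ((y # l) ! Suc i)}"
  have *: "{i. Suc i < length (x # y # l) \<and> R ((x # y # l) ! i) ((x # y # l) ! Suc i)}
      = (if R x y then {0} else {}) \<union> Suc ` ?A"
  proof (rule set_eqI)
    fix i
    show "i \<in> {i. Suc i < length (x # y # l) \<and> R ((x # y # l) ! i) ((x # y # l) ! Suc i)}
      \<longleftrightarrow> i \<in> (if R x y then {0} else {}) \<union> Suc ` ?A"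
      by (cases i) auto
  qed
  have "finite ?A"
    by (rule finite_subset[of _ "{..<length (y # l)}"]) auto
  then show ?case
    unfolding * by (subst sum.union_disjoint) (auto simp: sum.reindex 1)
qed auto

text \<open>The entries of the lists below carry a flag that says whether they are active.\<close>

abbreviation num_active :: "('b \<times> bool) list \<Rightarrow> nat" where
  "num_active l \<equiv> length (filter snd l)"

text \<open>Insertion of \<open>z\<close> after the first \<open>s\<close> entries.\<close>

definition insert_at :: "nat \<Rightarrow> 'b \<Rightarrow> 'b list \<Rightarrow> 'b list" where
  "insert_at s z l = take s l @ z # drop s l"

text \<open>Inserting a new entry into a list of length \<open>j\<close> with \<open>a\<close> active entries changes the
  major index by \<open>\<Delta>\<close>.  If \<open>t\<close> active entries precede the slot, then \<open>\<Delta> - t + a\<close> takes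
  each value in \<open>{0..j}\<close> exactly once as the slot varies; this number is \<open>e s\<close> below.  The
  classical case is the one without active entries.  The slots \<open>P\<close> in the proof are those where
  the number of descents does not increase: the last slot, the slots before an active entry and the slots
  in a descent.\<close>

lemma descent_insertion:
  fixes l :: "('b \<times> bool) list"
  assumes R: "\<And>x y. R x y \<Longrightarrow> \<not> snd y"
    and Z: "\<And>x. x \<in> set l \<Longrightarrow> \<not> R x z" "\<And>y. y \<in> set l \<Longrightarrow> R z y \<longleftrightarrow> \<not> snd y"
  shows "\<exists>e. bij_betw e {..length l} {..length l} \<and>
    (\<forall>s\<le>length l. rel_maj R 1 (insert_at s z l) + num_active (drop s l) = rel_maj R 1 l + e s)"
proof -
  define j where "j = length l"
  define P where "P s \<longleftrightarrow> s = j \<or> snd (l ! s) \<or> (0 < s \<and> R (l ! (s - 1)) (l ! s))" for s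
  define g where "g s = (if s = j then 0 else 1 + num_active (drop (Suc s) l) + rel_des R (drop s l))" for s
  have step: "g s = g (Suc s) + (if P (Suc s) then 1 else 0)" if "s < j" for s
  proof (cases "Suc s = j")
    case True
    then have "drop s l = [l ! s]"
      using that by (simp add: j_def flip: Cons_nth_drop_Suc)
    moreover have "drop (Suc s) l = []"
      using True by (simp add: j_def)
    ultimately show ?thesis by (simp add: g_def P_def flip: True)
  next
    case False
    then have "drop s l = l ! s # l ! Suc s # drop (Suc (Suc s)) l"
      using that by (simp add: j_def Cons_nth_drop_Suc)
    moreover have "drop (Suc s) l = l ! Suc s # drop (Suc (Suc s)) l"
      using that False by (simp add: j_def Cons_nth_drop_Suc)
    ultimately show ?thesis using that False R by (auto simp: g_def P_def)
  qed
  have "rel_maj R 1 (insert_at s z l) + num_active (drop s l)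
      = rel_maj R 1 l + (if P s then g s else s + g s)" if "s \<le> j" for s
  proof -
    define xs ys where "xs = take s l" and "ys = drop s l"
    have l: "l = xs @ ys" and len: "length xs = s"
      using that by (auto simp: xs_def ys_def j_def)
    have nR: "xs \<noteq> [] \<Longrightarrow> \<not> R (last xs) z"
      using Z(1) l by (metis last_in_set UnCI set_append)
    have xz: "rel_maj R 1 (insert_at s z l) = rel_maj R 1 xs + rel_maj R (Suc s) (z # ys)"
      using nR by (auto simp: insert_at_def rel_maj_append simp flip: xs_def ys_def simp: len)
    show ?thesis
    proof (cases ys)
      case Nil
      then have "s = j" using that l len by (simp add: j_def)
      then show ?thesis using xz Nil l by (auto simp: P_def g_def j_def)
    next
      case (Cons y ys')
      then have sj: "s < j" and ls: "l ! s = y" and tl: "drop (Suc s) l = ys'"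
        using that l len by (auto simp: j_def nth_append)
      have prev: "0 < s \<Longrightarrow> l ! (s - 1) = last xs"
        using len l by (metis One_nat_def diff_less last_conv_nth length_greater_0_conv nth_append zero_less_one)
      have zy: "R z y \<longleftrightarrow> \<not> snd y" using Z(2)[of y] l Cons by simp
      have "rel_maj R 1 (insert_at s z l) = rel_maj R 1 xs + rel_maj R (Suc s) ys + rel_des R ys
          + (if R z y then Suc s else 0)"
        using xz by (simp add: Cons rel_maj_Suc)
      moreover have "rel_maj R 1 l = rel_maj R 1 xs + rel_maj R (Suc s) ys
          + (if xs \<noteq> [] \<and> R (last xs) y then s else 0)"
        by (simp add: l rel_maj_append len Cons)
      moreover have "xs \<noteq> [] \<longleftrightarrow> 0 < s" using len by auto
      ultimately show ?thesis
        using R[of "last xs" y] zy sj ls tl prev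
        by (auto simp: Cons P_def g_def simp flip: ys_def)
    qed
  qed
  moreover have "g j = 0" by (simp add: g_def)
  ultimately show ?thesis
    using slot_label_bij[of j g P] step unfolding j_def by blast
qed

text \<open>The same statement for relations that hold from every inactive entry to the new one.  The slots
  \<open>P\<close> are now the first slot, the slots after an active entry and the slots in an ascent.\<close>

lemma ascent_insertion:
  fixes l :: "('b \<times> bool) list"
  assumes R: "\<And>x y. R x y \<Longrightarrow> \<not> snd x"
    and Z: "\<And>x. x \<in> set l \<Longrightarrow> R x z \<longleftrightarrow> \<not> snd x" "\<And>y. y \<in> set l \<Longrightarrow> \<not> R z y"
  shows "\<exists>e. bij_betw e {..length l} {..length l} \<and>
    (\<forall>s\<le>length l. rel_maj R 1 (insert_at s z l) + num_active (drop s l) = rel_maj R 1 l + e s)"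
proof -
  define j where "j = length l"
  define P where "P s \<longleftrightarrow> s = 0 \<or> snd (l ! (s - 1)) \<or> (s < j \<and> R (l ! (s - 1)) (l ! s))" for s
  define g where "g s = num_active (drop s l) + rel_des R (drop s l)" for s
  have step: "g s = g (Suc s) + (if P (Suc s) then 1 else 0)" if "s < j" for s
  proof (cases "Suc s = j")
    case True
    then have "drop s l = [l ! s]"
      using that by (simp add: j_def flip: Cons_nth_drop_Suc)
    moreover have "drop (Suc s) l = []"
      using True by (simp add: j_def)
    ultimately show ?thesis by (simp add: g_def P_def flip: True)
  next
    case False
    then have "drop s l = l ! s # l ! Suc s # drop (Suc (Suc s)) l"
      using that by (simp add: j_def Cons_nth_drop_Suc)
    moreover have "drop (Suc s) l = l ! Suc s # drop (Suc (Suc s)) l"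
      using that False by (simp add: j_def Cons_nth_drop_Suc)
    ultimately show ?thesis using that False R by (auto simp: g_def P_def)
  qed
  have "rel_maj R 1 (insert_at s z l) + num_active (drop s l)
      = rel_maj R 1 l + (if P s then g s else s + g s)" if "s \<le> j" for s
  proof -
    define xs ys where "xs = take s l" and "ys = drop s l"
    have l: "l = xs @ ys" and len: "length xs = s"
      using that by (auto simp: xs_def ys_def j_def)
    have "ys \<noteq> [] \<Longrightarrow> \<not> R z (hd ys)"
      using Z(2) l by (metis hd_in_set UnCI set_append)
    then have zy: "rel_maj R (Suc s) (z # ys) = rel_maj R (Suc s) ys + rel_des R ys"
      by (cases ys) (auto simp: rel_maj_Suc)
    show ?thesis
    proof (cases "s = 0")
      case True
      then show ?thesis using zy by (simp add: insert_at_def P_def g_def ys_def)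
    next
      case False
      then have ne: "xs \<noteq> []" and prev: "l ! (s - 1) = last xs"
        using len l by (auto simp: last_conv_nth nth_append)
      then have "R (last xs) z \<longleftrightarrow> \<not> snd (last xs)"
        using Z(1) l by simp
      moreover have "s < j \<longleftrightarrow> ys \<noteq> []" "ys \<noteq> [] \<Longrightarrow> l ! s = hd ys"
        using l len by (auto simp: j_def nth_append hd_conv_nth)
      moreover have "rel_maj R 1 (insert_at s z l) = rel_maj R 1 xs + rel_maj R (Suc s) ys + rel_des R ys
          + (if R (last xs) z then s else 0)"
        using zy ne by (simp add: insert_at_def rel_maj_append len flip: xs_def ys_def)
      moreover have "rel_maj R 1 l = rel_maj R 1 xs + rel_maj R (Suc s) ys
          + (if ys \<noteq> [] \<and> R (last xs) (hd ys) then s else 0)"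
        using ne by (simp add: l rel_maj_append len)
      ultimately show ?thesis
        using R[of "last xs" "hd ys"] False prev by (auto simp: P_def g_def simp flip: ys_def)
    qed
  qed
  moreover have "g j = 0" by (simp add: g_def j_def)
  ultimately show ?thesis
    using slot_label_bij[of j g P] step unfolding j_def by blast
qed

section \<open>Marked partitions and their statistics\<close>

text \<open>The sum of \<open>f x y\<close> over all pairs of entries with \<open>x\<close> to the left of \<open>y\<close>.\<close>

fun pair_sum :: "('b \<Rightarrow> 'b \<Rightarrow> nat) \<Rightarrow> 'b list \<Rightarrow> nat" where
  "pair_sum f [] = 0"
| "pair_sum f (x # xs) = (\<Sum>y\<leftarrow>xs. f x y) + pair_sum f xs"

lemma pair_sum_insert:
  "pair_sum f (xs @ z # ys) = pair_sum f (xs @ ys) + (\<Sum>x\<leftarrow>xs. f x z) + (\<Sum>y\<leftarrow>ys. f z y)"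
  by (induction xs) auto

text \<open>A block restricted to \<open>{1..n}\<close>, with a flag that is true if the block is active, that is,
  if larger elements are still to be added to it.\<close>

type_synonym marked_block = "nat set \<times> bool"

text \<open>The contribution of a pair of blocks, \<open>x\<close> to the left of \<open>y\<close>, to \<open>MAK\<close> and to
  \<open>lsb\<close>.  The closer of an active block counts as larger than every element.\<close>

definition mak_pair :: "marked_block \<Rightarrow> marked_block \<Rightarrow> nat" where
  "mak_pair x y = card {i \<in> fst x. Min (fst y) < i}
     + (if snd x then 0 else card {i \<in> fst y. Max (fst x) < i})"

definition lsb_pair :: "marked_block \<Rightarrow> marked_block \<Rightarrow> nat" where
  "lsb_pair x y = card {i \<in> fst y. Min (fst x) < i \<and> (snd x \<or> i < Max (fst x))}"

text \<open>Block descents and block ascents.  A block whose closer is not yet known cannot be the smaller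
  one.\<close>

definition block_desc :: "marked_block \<Rightarrow> marked_block \<Rightarrow> bool" where
  "block_desc x y \<longleftrightarrow> \<not> snd y \<and> Max (fst y) < Min (fst x)"

definition block_asc :: "marked_block \<Rightarrow> marked_block \<Rightarrow> bool" where
  "block_asc x y \<longleftrightarrow> \<not> snd x \<and> Max (fst x) < Min (fst y)"

text \<open>Ordered partitions of \<open>{1..n}\<close> with an arbitrary set of active blocks.\<close>

definition marked_partitions :: "nat \<Rightarrow> marked_block list set" where
  "marked_partitions n = {l. (\<forall>x\<in>set l. fst x \<noteq> {}) \<and>
     sorted_wrt (\<lambda>x y. fst x \<inter> fst y = {}) l \<and> (\<Union>x\<in>set l. fst x) = {1..n}}"

lemma marked_block_bounds:
  assumes "l \<in> marked_partitions n" "x \<in> set l"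
  shows "finite (fst x)" "fst x \<noteq> {}" "i \<in> fst x \<Longrightarrow> i < Suc n"
    "Min (fst x) < Suc n" "Max (fst x) < Suc n"
proof -
  have sub: "fst x \<subseteq> {1..n}" and ne: "fst x \<noteq> {}"
    using assms by (auto simp: marked_partitions_def)
  then show fin: "finite (fst x)" and "fst x \<noteq> {}" and "i \<in> fst x \<Longrightarrow> i < Suc n"
    using finite_subset by auto
  show "Min (fst x) < Suc n" "Max (fst x) < Suc n"
    using Min_in[OF fin ne] Max_in[OF fin ne] sub by auto
qed

text \<open>Addition of the element \<open>m\<close> to the block at position \<open>s\<close>, which then gets the flag
  \<open>c\<close>.\<close>

definition extend_at :: "nat \<Rightarrow> nat \<Rightarrow> bool \<Rightarrow> marked_block list \<Rightarrow> marked_block list" where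
  "extend_at m s c l = take s l @ (insert m (fst (l ! s)), c) # drop (Suc s) l"

lemma sum_list_const_count: "(\<Sum>x\<leftarrow>l. if snd x then 0 else 1) + num_active l = length l"
  by (induction l) auto

lemma sum_list_count: "(\<Sum>x\<leftarrow>l. if snd x then 1 else 0) = num_active l"
  by (induction l) auto

context
  fixes l :: "marked_block list" and n s :: nat
  assumes l: "l \<in> marked_partitions n"
begin

lemma pair_values_new:
  assumes "x \<in> set l"
  shows "mak_pair x ({Suc n}, c) = (if snd x then 0 else 1)" "mak_pair ({Suc n}, c) x = 1"
    "lsb_pair x ({Suc n}, c) = (if snd x then 1 else 0)" "lsb_pair ({Suc n}, c) x = 0"
proof -
  note b = marked_block_bounds[OF l assms]
  have "{i \<in> fst x. Suc n < i} = {}" "{i \<in> fst x. Suc n < i \<and> (c \<or> i < Suc n)} = {}"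
    using b(3) by fastforce+
  then have "card {i \<in> fst x. Suc n < i} = 0" "card {i \<in> fst x. Suc n < i \<and> (c \<or> i < Suc n)} = 0"
    by (simp_all only: card.empty)
  moreover have "{i. i = Suc n \<and> Min (fst x) < i} = {Suc n}" "{i. i = Suc n \<and> Max (fst x) < i} = {Suc n}"
    using b(4,5) by auto
  moreover have "{i. i = Suc n \<and> Min (fst x) < i \<and> (snd x \<or> i < Max (fst x))}
      = (if snd x then {Suc n} else {})"
    using b(4,5) by auto
  ultimately show "mak_pair x ({Suc n}, c) = (if snd x then 0 else 1)" "mak_pair ({Suc n}, c) x = 1"
    "lsb_pair x ({Suc n}, c) = (if snd x then 1 else 0)" "lsb_pair ({Suc n}, c) x = 0"
    by (simp_all add: mak_pair_def lsb_pair_def)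
qed

lemma pair_values_extend:
  assumes "x \<in> set l" "(B, True) \<in> set l"
  shows "mak_pair x (insert (Suc n) B, c) = mak_pair x (B, True) + (if snd x then 0 else 1)"
    "mak_pair (insert (Suc n) B, c) x = mak_pair (B, True) x + 1"
    "lsb_pair x (insert (Suc n) B, c) = lsb_pair x (B, True) + (if snd x then 1 else 0)"
    "lsb_pair (insert (Suc n) B, c) x = lsb_pair (B, True) x"
proof -
  note b = marked_block_bounds[OF l assms(1)] and b' = marked_block_bounds[OF l assms(2), simplified]
  have M: "Min (insert (Suc n) B) = Min B" "Max (insert (Suc n) B) = Suc n"
    using b'(4,5) by (simp_all add: Min_insert[OF b'(1,2)] Max_insert[OF b'(1,2)])
  have nB: "Suc n \<notin> B" using b'(3) by blast
  have *: "card {i \<in> insert (Suc n) B. Q i} = card {i \<in> B. Q i} + (if Q (Suc n) then 1 else 0)" for Q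
  proof -
    have "{i \<in> insert (Suc n) B. Q i} = (if Q (Suc n) then insert (Suc n) {i \<in> B. Q i} else {i \<in> B. Q i})"
      by auto
    then show ?thesis using nB b'(1) by auto
  qed
  have none: "{i \<in> fst x. Suc n < i} = {}"
    using b(3) by fastforce
  have all: "{i \<in> fst x. Min B < i \<and> (c \<or> i < Suc n)} = {i \<in> fst x. Min B < i}"
    using b(3) by auto
  show "mak_pair x (insert (Suc n) B, c) = mak_pair x (B, True) + (if snd x then 0 else 1)"
    "mak_pair (insert (Suc n) B, c) x = mak_pair (B, True) x + 1"
    "lsb_pair x (insert (Suc n) B, c) = lsb_pair x (B, True) + (if snd x then 1 else 0)"
    "lsb_pair (insert (Suc n) B, c) x = lsb_pair (B, True) x"
    unfolding mak_pair_def lsb_pair_def fst_conv snd_conv * M none all using b(4,5) by simp_all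
qed

text \<open>A new singleton block adds \<open>length l\<close> to the sum of the two statistics, and \<open>lsb\<close> takes
  from it one unit for every active block on the left.\<close>

lemma pair_sum_insert_at:
  assumes "s \<le> length l"
  shows "pair_sum mak_pair (insert_at s ({Suc n}, c) l) + num_active (take s l) = pair_sum mak_pair l + length l"
    and "pair_sum lsb_pair (insert_at s ({Suc n}, c) l) = pair_sum lsb_pair l + num_active (take s l)"
proof -
  define xs ys where "xs = take s l" and "ys = drop s l"
  have e: "l = xs @ ys" by (simp add: xs_def ys_def)
  have eqs: "(\<Sum>x\<leftarrow>xs. mak_pair x ({Suc n}, c)) = (\<Sum>x\<leftarrow>xs. if snd x then 0 else 1)"
    "(\<Sum>y\<leftarrow>ys. mak_pair ({Suc n}, c) y) = (\<Sum>y\<leftarrow>ys. 1)"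
    "(\<Sum>x\<leftarrow>xs. lsb_pair x ({Suc n}, c)) = (\<Sum>x\<leftarrow>xs. if snd x then 1 else 0)"
    "(\<Sum>y\<leftarrow>ys. lsb_pair ({Suc n}, c) y) = (\<Sum>y\<leftarrow>ys. 0)"
    by (intro arg_cong[of _ _ sum_list] map_cong refl pair_values_new; simp add: e)+
  have "pair_sum mak_pair l = pair_sum mak_pair (xs @ ys)" "pair_sum lsb_pair l = pair_sum lsb_pair (xs @ ys)"
    "length l = length xs + length ys"
    by (simp_all add: e)
  then show "pair_sum mak_pair (insert_at s ({Suc n}, c) l) + num_active (take s l) = pair_sum mak_pair l + length l"
    "pair_sum lsb_pair (insert_at s ({Suc n}, c) l) = pair_sum lsb_pair l + num_active (take s l)"
    using sum_list_const_count[of xs]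
    by (simp_all add: insert_at_def pair_sum_insert eqs sum_list_count sum_list_triv flip: xs_def ys_def)
qed

text \<open>Adding the new largest element to an active block adds \<open>length l - 1\<close> to the sum of the two
  statistics, which is split in the same way.\<close>

lemma pair_sum_extend_at:
  assumes "s < length l" "snd (l ! s)"
  shows "pair_sum mak_pair (extend_at (Suc n) s c l) + num_active (take s l) + 1 = pair_sum mak_pair l + length l"
    and "pair_sum lsb_pair (extend_at (Suc n) s c l) = pair_sum lsb_pair l + num_active (take s l)"
proof -
  define xs B ys where "xs = take s l" and "B = fst (l ! s)" and "ys = drop (Suc s) l"
  have "l ! s = (B, True)" using assms by (metis B_def prod.collapse)
  then have e: "l = xs @ (B, True) # ys"
    using id_take_nth_drop[OF assms(1)] by (simp add: xs_def ys_def)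
  have eqs: "(\<Sum>x\<leftarrow>xs. mak_pair x (insert (Suc n) B, c))
        = (\<Sum>x\<leftarrow>xs. mak_pair x (B, True) + (if snd x then 0 else 1))"
    "(\<Sum>y\<leftarrow>ys. mak_pair (insert (Suc n) B, c) y) = (\<Sum>y\<leftarrow>ys. mak_pair (B, True) y + 1)"
    "(\<Sum>x\<leftarrow>xs. lsb_pair x (insert (Suc n) B, c))
        = (\<Sum>x\<leftarrow>xs. lsb_pair x (B, True) + (if snd x then 1 else 0))"
    "(\<Sum>y\<leftarrow>ys. lsb_pair (insert (Suc n) B, c) y) = (\<Sum>y\<leftarrow>ys. lsb_pair (B, True) y)"
    by (intro arg_cong[of _ _ sum_list] map_cong refl pair_values_extend; simp add: e)+
  have "pair_sum mak_pair l = pair_sum mak_pair (xs @ (B, True) # ys)"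
    "pair_sum lsb_pair l = pair_sum lsb_pair (xs @ (B, True) # ys)"
    "length l = length xs + length ys + 1"
    by (simp_all add: e)
  then show "pair_sum mak_pair (extend_at (Suc n) s c l) + num_active (take s l) + 1 = pair_sum mak_pair l + length l"
    "pair_sum lsb_pair (extend_at (Suc n) s c l) = pair_sum lsb_pair l + num_active (take s l)"
    using sum_list_const_count[of xs]
    by (simp_all add: extend_at_def pair_sum_insert eqs sum_list_count sum_list_triv sum_list_addf sum_list_Suc
        flip: xs_def ys_def B_def)
qed

end

section \<open>Relations compatible with adjoining a largest element\<close>

text \<open>What the argument needs to know about a relation between blocks: a new singleton block changes
  its major index as in \<open>descent_insertion\<close>, and adding the new element to an active block does not
  change it.  Both block descents and block ascents qualify.\<close>

definition admissible :: "(marked_block \<Rightarrow> marked_block \<Rightarrow> bool) \<Rightarrow> bool" where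
  "admissible R \<longleftrightarrow> (\<forall>n. \<forall>l\<in>marked_partitions n. \<forall>c.
     (\<exists>e. bij_betw e {..length l} {..length l} \<and>
        (\<forall>s\<le>length l. rel_maj R 1 (insert_at s ({Suc n}, c) l) + num_active (drop s l) = rel_maj R 1 l + e s)) \<and>
     (\<forall>s<length l. snd (l ! s) \<longrightarrow> rel_maj R 1 (extend_at (Suc n) s c l) = rel_maj R 1 l))"

lemma rel_maj_cong:
  assumes "length l = length l'"
    and "\<And>i. Suc i < length l \<Longrightarrow> R (l ! i) (l ! Suc i) \<longleftrightarrow> R' (l' ! i) (l' ! Suc i)"
  shows "rel_maj R s l = rel_maj R' s l'"
  unfolding rel_maj_nth using assms by (auto intro!: sum.cong)

lemma extend_at_list_update:
  "s < length l \<Longrightarrow> extend_at m s c l = l[s := (insert m (fst (l ! s)), c)]"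
  by (simp add: extend_at_def upd_conv_take_nth_drop)

lemma rel_maj_extend_at:
  assumes l: "l \<in> marked_partitions n" and s: "s < length l" "snd (l ! s)"
    and R: "\<And>x B. \<lbrakk>x \<in> set l; l ! s = (B, True); finite B; B \<noteq> {}\<rbrakk> \<Longrightarrow>
      (R x (insert (Suc n) B, c) \<longleftrightarrow> R x (B, True)) \<and> (R (insert (Suc n) B, c) x \<longleftrightarrow> R (B, True) x)"
  shows "rel_maj R 1 (extend_at (Suc n) s c l) = rel_maj R 1 l"
proof -
  define B where "B = fst (l ! s)"
  have B: "l ! s = (B, True)" using s by (metis B_def prod.collapse)
  have "finite B" "B \<noteq> {}"
    using marked_block_bounds(1,2)[OF l nth_mem[OF s(1)]] B by auto
  then have R': "(R x (insert (Suc n) B, c) \<longleftrightarrow> R x (B, True)) \<and> (R (insert (Suc n) B, c) x \<longleftrightarrow> R (B, True) x)"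
    if "x \<in> set l" for x using R that B by blast
  have "rel_maj R 1 l = rel_maj R 1 (l[s := (insert (Suc n) B, c)])"
  proof (rule rel_maj_cong)
    fix i assume i: "Suc i < length l"
    then show "R (l ! i) (l ! Suc i) \<longleftrightarrow> R (l[s := (insert (Suc n) B, c)] ! i) (l[s := (insert (Suc n) B, c)] ! Suc i)"
      using R'[of "l ! i"] R'[of "l ! Suc i"] B
      by (cases "s = i"; cases "s = Suc i") (auto simp: nth_list_update)
  qed simp
  then show ?thesis using s by (simp add: extend_at_list_update B_def)
qed

lemma admissible_block_desc: "admissible block_desc"
  unfolding admissible_def
proof (intro allI ballI conjI impI)
  fix n l c assume l: "l \<in> marked_partitions n"
  note b = marked_block_bounds[OF l]
  show "\<exists>e. bij_betw e {..length l} {..length l} \<and> (\<forall>s\<le>length l.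
      rel_maj block_desc 1 (insert_at s ({Suc n}, c) l) + num_active (drop s l) = rel_maj block_desc 1 l + e s)"
    by (rule descent_insertion) (use b in \<open>force simp: block_desc_def\<close>)+
  fix s assume s: "s < length l" "snd (l ! s)"
  show "rel_maj block_desc 1 (extend_at (Suc n) s c l) = rel_maj block_desc 1 l"
  proof (rule rel_maj_extend_at[OF l s])
    fix x B assume "x \<in> set l" "l ! s = (B, True)" "finite B" "B \<noteq> {}"
    moreover from this have "Min B < Suc n" using b(4)[OF nth_mem[OF s(1)]] by simp
    ultimately show "(block_desc x (insert (Suc n) B, c) \<longleftrightarrow> block_desc x (B, True)) \<and>
        (block_desc (insert (Suc n) B, c) x \<longleftrightarrow> block_desc (B, True) x)"
      using b(4)[of x] by (auto simp: block_desc_def)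
  qed
qed

lemma admissible_block_asc: "admissible block_asc"
  unfolding admissible_def
proof (intro allI ballI conjI impI)
  fix n l c assume l: "l \<in> marked_partitions n"
  note b = marked_block_bounds[OF l]
  show "\<exists>e. bij_betw e {..length l} {..length l} \<and> (\<forall>s\<le>length l.
      rel_maj block_asc 1 (insert_at s ({Suc n}, c) l) + num_active (drop s l) = rel_maj block_asc 1 l + e s)"
    by (rule ascent_insertion) (use b in \<open>force simp: block_asc_def\<close>)+
  fix s assume s: "s < length l" "snd (l ! s)"
  show "rel_maj block_asc 1 (extend_at (Suc n) s c l) = rel_maj block_asc 1 l"
  proof (rule rel_maj_extend_at[OF l s])
    fix x B assume "x \<in> set l" "l ! s = (B, True)" "finite B" "B \<noteq> {}"
    moreover from this have "Min B < Suc n" using b(4)[OF nth_mem[OF s(1)]] by simp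
    ultimately show "(block_asc x (insert (Suc n) B, c) \<longleftrightarrow> block_asc x (B, True)) \<and>
        (block_asc (insert (Suc n) B, c) x \<longleftrightarrow> block_asc (B, True) x)"
      using b(4)[of x] by (auto simp: block_asc_def)
  qed
qed

section \<open>Removing the largest element\<close>

text \<open>Every marked partition of \<open>{1..n+1}\<close> arises in exactly one way from one of \<open>{1..n}\<close>,
  either by inserting the singleton \<open>{n+1}\<close> at a slot, or by adding \<open>n+1\<close> to an active block.
  In both cases the new flag \<open>c\<close> of the affected block is free.\<close>

definition insertions :: "nat \<Rightarrow> (marked_block list \<times> nat \<times> bool) set" where
  "insertions n = (SIGMA l:marked_partitions n. {..length l} \<times> UNIV)"

definition extensions :: "nat \<Rightarrow> (marked_block list \<times> nat \<times> bool) set" where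
  "extensions n = (SIGMA l:marked_partitions n. {s. s < length l \<and> snd (l ! s)} \<times> UNIV)"

lemma not_in_marked_partition: "l \<in> marked_partitions n \<Longrightarrow> x \<in> set l \<Longrightarrow> Suc n \<notin> fst x"
  using marked_block_bounds(3) by blast

lemma unique_split:
  assumes "xs @ z # ys = xs' @ z' # ys'" "P z" "P z'"
    "\<And>x. x \<in> set xs \<Longrightarrow> \<not> P x" "\<And>x. x \<in> set xs' \<Longrightarrow> \<not> P x"
  shows "xs = xs' \<and> z = z' \<and> ys = ys'"
proof -
  have "takeWhile (\<lambda>x. \<not> P x) (xs @ z # ys) = xs" "takeWhile (\<lambda>x. \<not> P x) (xs' @ z' # ys') = xs'"
    using assms(2-5) by (simp_all add: takeWhile_tail)
  then show ?thesis using assms(1) by auto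
qed

lemma unique_split_marked:
  assumes "take s l @ z # drop t l = take s' l' @ z' # drop t' l'"
    and "l \<in> marked_partitions n" "l' \<in> marked_partitions n" "Suc n \<in> fst z" "Suc n \<in> fst z'"
  shows "take s l = take s' l' \<and> z = z' \<and> drop t l = drop t' l'"
  using assms(4,5) not_in_marked_partition[OF assms(2)] not_in_marked_partition[OF assms(3)]
  by (intro unique_split[OF assms(1), of "\<lambda>x. Suc n \<in> fst x"]) (auto dest: in_set_takeD)

lemma inj_on_insert_at:
  "inj_on (\<lambda>(l, s, c). insert_at s ({Suc n}, c) l) (insertions n)"
proof (rule inj_onI, unfold split_paired_all prod.case)
  fix l s c l' s' c'
  assume A: "(l, s, c) \<in> insertions n" "(l', s', c') \<in> insertions n"
    and eq: "insert_at s ({Suc n}, c) l = insert_at s' ({Suc n}, c') l'"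
  have *: "take s l = take s' l' \<and> ({Suc n}, c) = ({Suc n}, c') \<and> drop s l = drop s' l'"
    using A by (intro unique_split_marked[OF eq[unfolded insert_at_def], of n]) (auto simp: insertions_def)
  then have "l = l'" by (metis append_take_drop_id)
  have "s = length (take s l)" "s' = length (take s' l')"
    using A by (auto simp: insertions_def)
  with * have "s = s'" by metis
  with * \<open>l = l'\<close> show "(l, s, c) = (l', s', c')" by simp
qed

lemma inj_on_extend_at:
  "inj_on (\<lambda>(l, s, c). extend_at (Suc n) s c l) (extensions n)"
proof (rule inj_onI, unfold split_paired_all prod.case)
  fix l s c l' s' c'
  assume A: "(l, s, c) \<in> extensions n" "(l', s', c') \<in> extensions n"
    and eq: "extend_at (Suc n) s c l = extend_at (Suc n) s' c' l'"
  have s: "s < length l" "s' < length l'" and m: "snd (l ! s)" "snd (l' ! s')"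
    and mp: "l \<in> marked_partitions n" "l' \<in> marked_partitions n"
    using A by (auto simp: extensions_def)
  have *: "take s l = take s' l' \<and> (insert (Suc n) (fst (l ! s)), c) = (insert (Suc n) (fst (l' ! s')), c')
      \<and> drop (Suc s) l = drop (Suc s') l'"
    using mp by (intro unique_split_marked[OF eq[unfolded extend_at_def], of n]) auto
  moreover have "Suc n \<notin> fst (l ! s)" "Suc n \<notin> fst (l' ! s')"
    using not_in_marked_partition mp s nth_mem by blast+
  ultimately have "fst (l ! s) = fst (l' ! s')"
    by (metis insert_ident prod.inject)
  with m have "l ! s = l' ! s'" by (simp add: prod_eq_iff)
  with * have "l = l'"
    using id_take_nth_drop[OF s(1)] id_take_nth_drop[OF s(2)] by metis
  have "s = length (take s l)" "s' = length (take s' l')"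
    using s by auto
  with * have "s = s'" by metis
  with * \<open>l = l'\<close> show "(l, s, c) = (l', s', c')" by simp
qed

lemma insert_at_neq_extend_at:
  assumes "(l, s, c) \<in> insertions n" "(l', s', c') \<in> extensions n"
  shows "insert_at s ({Suc n}, c) l \<noteq> extend_at (Suc n) s' c' l'"
proof
  assume eq: "insert_at s ({Suc n}, c) l = extend_at (Suc n) s' c' l'"
  have mp: "l \<in> marked_partitions n" "l' \<in> marked_partitions n" "s' < length l'"
    using assms by (auto simp: insertions_def extensions_def)
  have "({Suc n}, c) = (insert (Suc n) (fst (l' ! s')), c')"
    using unique_split_marked[OF eq[unfolded insert_at_def extend_at_def] mp(1,2)] by auto
  then have "fst (l' ! s') \<subseteq> {Suc n}" by auto
  then show False
    using not_in_marked_partition[OF mp(2) nth_mem[OF mp(3)]]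
      marked_block_bounds(2)[OF mp(2) nth_mem[OF mp(3)]] by auto
qed

lemma insert_at_in_marked_partitions:
  assumes "l \<in> marked_partitions n"
  shows "insert_at s ({Suc n}, c) l \<in> marked_partitions (Suc n)"
proof -
  define xs ys where "xs = take s l" and "ys = drop s l"
  have e: "l = xs @ ys" by (simp add: xs_def ys_def)
  have "Suc n \<notin> fst x" if "x \<in> set xs \<union> set ys" for x
    using not_in_marked_partition[OF assms] that by (auto simp: e)
  then show ?thesis
    using assms unfolding insert_at_def xs_def[symmetric] ys_def[symmetric]
    by (auto simp: marked_partitions_def sorted_wrt_append e atLeastAtMostSuc_conv)
qed

lemma extend_at_in_marked_partitions:
  assumes "l \<in> marked_partitions n" "s < length l"
  shows "extend_at (Suc n) s c l \<in> marked_partitions (Suc n)"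
proof -
  define xs x ys where "xs = take s l" and "x = l ! s" and "ys = drop (Suc s) l"
  have e: "l = xs @ x # ys"
    using id_take_nth_drop[OF assms(2)] by (simp add: xs_def x_def ys_def)
  have "Suc n \<notin> fst x" if "x \<in> set xs \<union> set ys" for x
    using not_in_marked_partition[OF assms(1)] that by (auto simp: e)
  then show ?thesis
    using assms(1) unfolding extend_at_def xs_def[symmetric] x_def[symmetric] ys_def[symmetric]
    by (auto simp: marked_partitions_def sorted_wrt_append e atLeastAtMostSuc_conv)
qed

lemma marked_partitions_Suc:
  "marked_partitions (Suc n) =
     (\<lambda>(l, s, c). insert_at s ({Suc n}, c) l) ` insertions n \<union>
     (\<lambda>(l, s, c). extend_at (Suc n) s c l) ` extensions n" (is "_ = ?I \<union> ?E")
proof (rule set_eqI, rule iffI)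
  fix l assume l: "l \<in> marked_partitions (Suc n)"
  then have "Suc n \<in> (\<Union>x\<in>set l. fst x)" by (simp add: marked_partitions_def)
  then obtain B c where "(B, c) \<in> set l" and m: "Suc n \<in> B" by auto
  then obtain xs ys where e: "l = xs @ (B, c) # ys" by (meson split_list)
  have disj: "fst x \<inter> B = {}" if "x \<in> set xs \<union> set ys" for x
    using l that by (auto simp: marked_partitions_def e sorted_wrt_append)
  then have nm: "Suc n \<notin> fst x" if "x \<in> set xs \<union> set ys" for x
    using m that by blast
  have un: "(\<Union>x\<in>set xs \<union> set ys. fst x) \<union> B = {1..Suc n}"
    using l by (auto simp: marked_partitions_def e)
  have "Suc n \<notin> (\<Union>x\<in>set xs \<union> set ys. fst x)"
    using nm unfolding UN_iff by metis
  then have "(\<Union>x\<in>set xs \<union> set ys. fst x) - {Suc n} = (\<Union>x\<in>set xs \<union> set ys. fst x)"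
    by (rule Diff_insert0[of _ _ "{}", unfolded Diff_empty])
  then have "(\<Union>x\<in>set xs \<union> set ys. fst x) \<union> (B - {Suc n})
      = ((\<Union>x\<in>set xs \<union> set ys. fst x) \<union> B) - {Suc n}"
    unfolding Un_Diff by (rule arg_cong2[OF sym refl])
  also have "\<dots> = {1..n}" unfolding un by auto
  finally have un': "(\<Union>x\<in>set xs \<union> set ys. fst x) \<union> (B - {Suc n}) = {1..n}" .
  show "l \<in> ?I \<union> ?E"
  proof (cases "B = {Suc n}")
    case True
    have "xs @ ys \<in> marked_partitions n"
      using l un' True by (auto simp: marked_partitions_def e sorted_wrt_append)
    moreover have "l = insert_at (length xs) ({Suc n}, c) (xs @ ys)"
      by (simp add: e insert_at_def True)
    ultimately show ?thesis
      by (intro UnI1 image_eqI[of _ _ "(xs @ ys, length xs, c)"]) (auto simp: insertions_def)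
  next
    case False
    define l' where "l' = xs @ (B - {Suc n}, True) # ys"
    have "\<forall>x\<in>set l'. fst x \<noteq> {}"
      using l False m by (auto simp: marked_partitions_def e l'_def)
    moreover have "sorted_wrt (\<lambda>x y. fst x \<inter> fst y = {}) l'"
      using l by (auto simp: marked_partitions_def e l'_def sorted_wrt_append)
    moreover have "(\<Union>x\<in>set l'. fst x) = {1..n}"
      using un' by (auto simp: l'_def)
    ultimately have "l' \<in> marked_partitions n" by (simp add: marked_partitions_def)
    moreover have "l = extend_at (Suc n) (length xs) c l'"
      using m by (simp add: e extend_at_def l'_def insert_absorb)
    ultimately show ?thesis
      by (intro UnI2 image_eqI[of _ _ "(l', length xs, c)"]) (auto simp: extensions_def l'_def)
  qed
next
  fix l assume "l \<in> ?I \<union> ?E"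
  then show "l \<in> marked_partitions (Suc n)"
    using insert_at_in_marked_partitions extend_at_in_marked_partitions
    by (auto simp: insertions_def extensions_def)
qed

lemma marked_partitions_0: "marked_partitions 0 = {[]}"
proof (rule set_eqI)
  fix l show "l \<in> marked_partitions 0 \<longleftrightarrow> l \<in> {[]}"
    by (cases l) (auto simp: marked_partitions_def)
qed

lemma finite_insertions: "finite (marked_partitions n) \<Longrightarrow> finite (insertions n)"
  and finite_extensions: "finite (marked_partitions n) \<Longrightarrow> finite (extensions n)"
  unfolding insertions_def extensions_def by (auto intro!: finite_SigmaI finite_cartesian_product)

lemma finite_marked_partitions: "finite (marked_partitions n)"
  by (induction n)
    (simp_all add: marked_partitions_0 marked_partitions_Suc finite_insertions finite_extensions)

lemma sum_marked_partitions_Suc: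
  fixes f :: "marked_block list \<Rightarrow> 'a::comm_monoid_add"
  shows "(\<Sum>l\<in>marked_partitions (Suc n). f l) =
    (\<Sum>l\<in>marked_partitions n. \<Sum>s\<le>length l. \<Sum>c\<in>UNIV. f (insert_at s ({Suc n}, c) l)) +
    (\<Sum>l\<in>marked_partitions n. \<Sum>s | s < length l \<and> snd (l ! s). \<Sum>c\<in>UNIV. f (extend_at (Suc n) s c l))"
proof -
  have "(\<Sum>l\<in>marked_partitions (Suc n). f l) =
      (\<Sum>l\<in>(\<lambda>(l, s, c). insert_at s ({Suc n}, c) l) ` insertions n. f l) +
      (\<Sum>l\<in>(\<lambda>(l, s, c). extend_at (Suc n) s c l) ` extensions n. f l)"
    unfolding marked_partitions_Suc
    by (rule sum.union_disjoint)
      (use insert_at_neq_extend_at in \<open>auto simp: finite_insertions finite_extensions finite_marked_partitions\<close>)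
  then show ?thesis
    unfolding sum.reindex[OF inj_on_insert_at] sum.reindex[OF inj_on_extend_at]
    by (simp add: insertions_def extensions_def finite_marked_partitions case_prod_unfold
        sum.cartesian_product sum.Sigma)
qed

lemma num_active_insert_at: "num_active (insert_at s (B, c) l) = (if c then Suc (num_active l) else num_active l)"
proof -
  have "num_active l = num_active (take s l) + num_active (drop s l)"
    by (metis append_take_drop_id filter_append length_append)
  then show ?thesis by (simp add: insert_at_def)
qed

lemma num_active_extend_at:
  assumes "s < length l" "snd (l ! s)"
  shows "num_active (extend_at m s c l) = (if c then num_active l else num_active l - 1)"
proof -
  have "num_active l = num_active (take s l @ l ! s # drop (Suc s) l)"
    using id_take_nth_drop[OF assms(1)] by simp
  then show ?thesis using assms by (simp add: extend_at_def)
qed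

lemma length_insert_at: "length (insert_at s z l) = Suc (length l)"
  by (simp add: insert_at_def)

lemma length_extend_at: "s < length l \<Longrightarrow> length (extend_at m s c l) = length l"
  by (simp add: extend_at_list_update)

text \<open>The \<open>r\<close>-th active entry has \<open>r - 1\<close> active entries on its left.\<close>

lemma sum_over_marked:
  "(\<Sum>s | s < length l \<and> snd (l ! s). h (num_active (take s l))) = (\<Sum>r<num_active l. h r)"
proof (induction l rule: rev_induct)
  case (snoc x l)
  let ?S = "\<lambda>l. {s. s < length l \<and> snd (l ! s)}"
  have fin: "finite (?S l)" by simp
  have "?S (l @ [x]) = (if snd x then insert (length l) (?S l) else ?S l)"
    by (auto simp: nth_append less_Suc_eq)
  then show ?case using snoc.IH fin by (auto simp: add.commute)
qed simp

section \<open>Weights\<close>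

text \<open>The summand of the theorem without the constant factor \<open>q ^ (k choose 2)\<close>, for marked
  partitions.  By \<open>rel_maj_le\<close> the subtraction never truncates.\<close>

definition weight :: "(marked_block \<Rightarrow> marked_block \<Rightarrow> bool) \<Rightarrow> 'a::comm_semiring_1 \<Rightarrow> 'a \<Rightarrow> marked_block list \<Rightarrow> 'a"
  where "weight R p q l = p ^ (pair_sum mak_pair l + rel_maj R 1 l)
     * q ^ (pair_sum lsb_pair l + ((length l choose 2) - rel_maj R 1 l))"

lemma sum_weight_insert_at:
  assumes R: "admissible R" and l: "l \<in> marked_partitions n"
  shows "(\<Sum>s\<le>length l. weight R p q (insert_at s ({Suc n}, c) l)) =
    weight R p q l * (p ^ (length l - num_active l) * q ^ num_active l * pq_bracket p q (Suc (length l)))"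
proof -
  define j where "j = length l"
  obtain e where e: "bij_betw e {..j} {..j}" and
    maj: "\<And>s. s \<le> j \<Longrightarrow> rel_maj R 1 (insert_at s ({Suc n}, c) l) + num_active (drop s l) = rel_maj R 1 l + e s"
    using R l unfolding admissible_def j_def by blast
  have "weight R p q (insert_at s ({Suc n}, c) l) =
      weight R p q l * (p ^ (j - num_active l) * q ^ num_active l * (p ^ e s * q ^ (j - e s)))" if s: "s \<le> j" for s
  proof -
    have a: "num_active l = num_active (take s l) + num_active (drop s l)"
      by (metis append_take_drop_id filter_append length_append)
    have aj: "num_active l \<le> j" by (simp add: j_def)
    have es: "e s \<le> j" using bij_betwE[OF e] s by auto
    note pairs = pair_sum_insert_at[OF l s[unfolded j_def], of c, folded j_def]
    have le: "rel_maj R 1 l \<le> j choose 2"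
      "rel_maj R 1 (insert_at s ({Suc n}, c) l) \<le> (j choose 2) + j"
      using rel_maj_le[of R l] rel_maj_le[of R "insert_at s ({Suc n}, c) l"]
      by (simp_all add: j_def length_insert_at choose_2_Suc)
    have P: "pair_sum mak_pair (insert_at s ({Suc n}, c) l) + rel_maj R 1 (insert_at s ({Suc n}, c) l)
        = pair_sum mak_pair l + rel_maj R 1 l + (j - num_active l) + e s"
      using pairs(1) maj[OF s] a aj by linarith
    have Q: "pair_sum lsb_pair (insert_at s ({Suc n}, c) l)
          + ((j choose 2) + j - rel_maj R 1 (insert_at s ({Suc n}, c) l))
        = pair_sum lsb_pair l + ((j choose 2) - rel_maj R 1 l) + num_active l + (j - e s)"
      using pairs(2) maj[OF s] a le es by linarith
    show ?thesis
      unfolding weight_def length_insert_at choose_2_Suc P Q j_def[symmetric]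
      by (simp add: power_add algebra_simps)
  qed
  then have "(\<Sum>s\<le>j. weight R p q (insert_at s ({Suc n}, c) l)) =
      weight R p q l * (p ^ (j - num_active l) * q ^ num_active l * (\<Sum>s\<le>j. p ^ e s * q ^ (j - e s)))"
    by (simp add: sum_distrib_left)
  also have "(\<Sum>s\<le>j. p ^ e s * q ^ (j - e s)) = pq_bracket p q (Suc j)"
    unfolding pq_bracket_atMost by (rule sum.reindex_bij_betw[OF e])
  finally show ?thesis by (simp add: j_def)
qed

lemma sum_weight_extend_at:
  assumes R: "admissible R" and l: "l \<in> marked_partitions n"
  shows "(\<Sum>s | s < length l \<and> snd (l ! s). weight R p q (extend_at (Suc n) s c l)) =
    weight R p q l * (p ^ (length l - num_active l) * pq_bracket p q (num_active l))"
proof -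
  define j a where "j = length l" and "a = num_active l"
  have "weight R p q (extend_at (Suc n) s c l) = weight R p q l *
      (p ^ (j - a) * (p ^ (a - 1 - num_active (take s l)) * q ^ num_active (take s l)))"
    if s: "s < length l" "snd (l ! s)" for s
  proof -
    have maj: "rel_maj R 1 (extend_at (Suc n) s c l) = rel_maj R 1 l"
      using R l s unfolding admissible_def by blast
    have "a = num_active (take s l @ l ! s # drop (Suc s) l)"
      using id_take_nth_drop[OF s(1)] by (simp add: a_def)
    then have "num_active (take s l) < a" using s by simp
    moreover have "a \<le> j" by (simp add: a_def j_def)
    ultimately have P: "pair_sum mak_pair (extend_at (Suc n) s c l) =
        pair_sum mak_pair l + (j - a) + (a - 1 - num_active (take s l))"
      using pair_sum_extend_at(1)[OF l s, of c] by (simp add: j_def)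
    show ?thesis
      unfolding weight_def length_extend_at[OF s(1)] maj P pair_sum_extend_at(2)[OF l s]
      by (simp add: power_add algebra_simps)
  qed
  then have "(\<Sum>s | s < length l \<and> snd (l ! s). weight R p q (extend_at (Suc n) s c l)) =
      weight R p q l * (p ^ (j - a) *
        (\<Sum>s | s < length l \<and> snd (l ! s). p ^ (a - 1 - num_active (take s l)) * q ^ num_active (take s l)))"
    by (simp add: sum_distrib_left)
  also have "(\<Sum>s | s < length l \<and> snd (l ! s). p ^ (a - 1 - num_active (take s l)) * q ^ num_active (take s l))
      = pq_bracket p q a"
    unfolding pq_bracket_def a_def by (rule sum_over_marked)
  finally show ?thesis by (simp add: j_def a_def)
qed

text \<open>The distribution of the weight over marked partitions, with the number of blocks and of active
  blocks recorded by an arbitrary function \<open>\<phi>\<close>.  In the induction step the operators of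
  \<open>marking_sum\<close> and \<open>marking_sum_extend\<close> appear, one for each of the two ways of adjoining
  \<open>n+1\<close>, with the factors \<open>[j + 1]\<close> and \<open>[j]\<close>.  The first factor builds up \<open>[j]!\<close>, the
  second is that of the Stirling recursion.\<close>

lemma sum_weight_marked_partitions:
  fixes p q :: "'a::comm_semiring_1" and \<phi> :: "nat \<Rightarrow> nat \<Rightarrow> 'a"
  assumes R: "admissible R"
  shows "(\<Sum>l\<in>marked_partitions n. weight R p q l * \<phi> (length l) (num_active l)) =
    (\<Sum>j\<le>n. pq_fact p q j * red_Stirling p q n j * marking_sum p q j (\<phi> j))"
proof (induction n arbitrary: \<phi>)
  case 0
  show ?case by (simp add: marked_partitions_0 weight_def pq_fact_def numeral_2_eq_2)
next
  case (Suc n)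
  define T where "T = (\<lambda>j a. p ^ (j - a) * q ^ a * (\<phi> (Suc j) (Suc a) + \<phi> (Suc j) a))"
  define U where "U = (\<lambda>j a. p ^ (j - a) * pq_bracket p q a * (\<phi> j a + \<phi> j (a - 1)))"
  define G where "G = (\<lambda>j. pq_fact p q j * marking_sum p q j (\<phi> j))"
  have ins: "(\<Sum>s\<le>length l. \<Sum>c\<in>UNIV. weight R p q (insert_at s ({Suc n}, c) l)
        * \<phi> (length (insert_at s ({Suc n}, c) l)) (num_active (insert_at s ({Suc n}, c) l)))
      = weight R p q l * (pq_bracket p q (Suc (length l)) * T (length l) (num_active l))"
    if "l \<in> marked_partitions n" for l
    by (simp add: UNIV_bool num_active_insert_at length_insert_at sum.distrib sum_weight_insert_at[OF R that]
        flip: sum_distrib_right) (simp add: T_def algebra_simps)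
  have ext: "(\<Sum>s | s < length l \<and> snd (l ! s). \<Sum>c\<in>UNIV. weight R p q (extend_at (Suc n) s c l)
        * \<phi> (length (extend_at (Suc n) s c l)) (num_active (extend_at (Suc n) s c l)))
      = weight R p q l * U (length l) (num_active l)"
    if "l \<in> marked_partitions n" for l
    by (simp add: UNIV_bool num_active_extend_at length_extend_at sum.distrib sum_weight_extend_at[OF R that]
        flip: sum_distrib_right) (simp add: U_def algebra_simps)
  have "(\<Sum>l\<in>marked_partitions (Suc n). weight R p q l * \<phi> (length l) (num_active l)) =
      (\<Sum>l\<in>marked_partitions n. weight R p q l *
        (pq_bracket p q (Suc (length l)) * T (length l) (num_active l) + U (length l) (num_active l)))"
    unfolding sum_marked_partitions_Suc by (simp add: ins ext distrib_left sum.distrib)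
  also have "\<dots> = (\<Sum>j\<le>n. pq_fact p q j * red_Stirling p q n j *
      marking_sum p q j (\<lambda>a. pq_bracket p q (Suc j) * T j a + U j a))"
    by (rule Suc.IH)
  also have "\<dots> = (\<Sum>j\<le>n. red_Stirling p q n j * (G (Suc j) + pq_bracket p q j * G j))"
  proof (rule sum.cong)
    fix j
    have "marking_sum p q j (T j) = marking_sum p q (Suc j) (\<phi> (Suc j))"
      by (simp add: T_def)
    moreover have "marking_sum p q j (U j) = pq_bracket p q j * marking_sum p q j (\<phi> j)"
      unfolding U_def by (rule marking_sum_extend)
    ultimately show "pq_fact p q j * red_Stirling p q n j *
        marking_sum p q j (\<lambda>a. pq_bracket p q (Suc j) * T j a + U j a)
        = red_Stirling p q n j * (G (Suc j) + pq_bracket p q j * G j)"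
      unfolding marking_sum_add marking_sum_scale G_def pq_fact_Suc
      by (simp add: algebra_simps del: marking_sum.simps)
  qed simp
  also have "\<dots> = (\<Sum>j\<le>n. red_Stirling p q n j * G (Suc j))
      + (\<Sum>j\<le>Suc n. red_Stirling p q n j * (pq_bracket p q j * G j))"
    by (simp add: distrib_left sum.distrib red_Stirling_eq_0)
  also have "\<dots> = (\<Sum>j\<le>Suc n. red_Stirling p q (Suc n) j * G j)"
    by (simp add: sum.atMost_Suc_shift sum.distrib[symmetric] algebra_simps del: sum.atMost_Suc)
  finally show ?case by (simp add: G_def algebra_simps)
qed

corollary sum_weight_unmarked:
  fixes p q :: "'a::comm_semiring_1"
  assumes R: "admissible R" and "k \<le> n"
  shows "(\<Sum>l | l \<in> marked_partitions n \<and> length l = k \<and> num_active l = 0. weight R p q l)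
    = pq_fact p q k * pq_Stirling p q n k"
proof -
  define \<phi> :: "nat \<Rightarrow> nat \<Rightarrow> 'a" where "\<phi> j a = (if j = k then if a = 0 then 1 else 0 else 0)" for j a
  have "(\<Sum>l | l \<in> marked_partitions n \<and> length l = k \<and> num_active l = 0. weight R p q l)
      = (\<Sum>l\<in>marked_partitions n. weight R p q l * \<phi> (length l) (num_active l))"
    by (rule sum.mono_neutral_cong_left) (auto simp: finite_marked_partitions \<phi>_def)
  also have "\<dots> = (\<Sum>j\<le>n. if j = k then pq_fact p q k * red_Stirling p q n k * p ^ (k choose 2) else 0)"
    unfolding sum_weight_marked_partitions[OF R]
  proof (rule sum.cong)
    fix j
    have "marking_sum p q j (\<lambda>_. 0) = 0" using marking_sum_scale[of p q j 0] by simp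
    moreover have "\<phi> k = (\<lambda>a. if a = 0 then 1 else 0)" "j \<noteq> k \<Longrightarrow> \<phi> j = (\<lambda>_. 0)"
      by (simp_all add: \<phi>_def fun_eq_iff)
    ultimately show "pq_fact p q j * red_Stirling p q n j * marking_sum p q j (\<phi> j)
        = (if j = k then pq_fact p q k * red_Stirling p q n k * p ^ (k choose 2) else 0)"
      by (simp add: marking_sum_indicator_0)
  qed simp
  finally show ?thesis using assms(2) by (simp add: pq_Stirling_red mult.commute mult.left_commute)
qed

section \<open>Statistics of ordered partitions as sums over pairs of blocks\<close>

lemma pair_sum_nth:
  "pair_sum f l = (\<Sum>w<length l. \<Sum>b<length l. if w < b then f (l ! w) (l ! b) else 0)"
proof (induction l)
  case (Cons x l)
  have "(\<Sum>y\<leftarrow>l. f x y) = (\<Sum>b<length l. f x (l ! b))"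
    by (simp add: sum_list_sum_nth atLeast0LessThan)
  then show ?case by (simp add: sum.lessThan_Suc_shift Cons del: sum.lessThan_Suc cong: if_cong)
qed simp

lemma sum_index_pairs:
  fixes F G :: "nat \<Rightarrow> nat \<Rightarrow> nat"
  shows "(\<Sum>w<k. \<Sum>b<k. if w < b then F w b else 0) + (\<Sum>w<k. \<Sum>b<k. if b < w then G w b else 0)
    = (\<Sum>w<k. \<Sum>b<k. if w < b then F w b + G b w else 0)"
proof -
  have "(\<Sum>w<k. \<Sum>b<k. if b < w then G w b else 0) = (\<Sum>w<k. \<Sum>b<k. if w < b then G b w else 0)"
    by (rule sum.swap)
  then show ?thesis by (auto simp: sum.distrib[symmetric] intro!: sum.cong)
qed

context
  fixes \<pi> :: "nat set list" and n k :: nat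
  assumes \<pi>: "\<pi> \<in> ordered_partitions n k"
begin

lemma ordered_partition_facts:
  shows "length \<pi> = k" "\<Union> (set \<pi>) = {1..n}"
    "\<And>w. w < k \<Longrightarrow> finite (\<pi> ! w)" "\<And>w. w < k \<Longrightarrow> \<pi> ! w \<noteq> {}"
    "\<And>w b i. \<lbrakk>w < k; b < k; i \<in> \<pi> ! w; i \<in> \<pi> ! b\<rbrakk> \<Longrightarrow> w = b"
proof -
  show len: "length \<pi> = k" and un: "\<Union> (set \<pi>) = {1..n}"
    using \<pi> by (auto simp: ordered_partitions_def)
  show "finite (\<pi> ! w)" if "w < k" for w
    using un nth_mem[of w \<pi>] that len by (metis Union_upper finite_atLeastAtMost finite_subset)
  show "\<pi> ! w \<noteq> {}" if "w < k" for w
    using \<pi> nth_mem[of w \<pi>] that len unfolding ordered_partitions_def by fastforce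
  show "w = b" if "w < k" "b < k" "i \<in> \<pi> ! w" "i \<in> \<pi> ! b" for w b i
    using \<pi> that by (auto simp: ordered_partitions_def disjoint_family_on_def)
qed

lemma block_index_eq: "w < k \<Longrightarrow> i \<in> \<pi> ! w \<Longrightarrow> block_index \<pi> i = w"
  unfolding block_index_def using ordered_partition_facts(1,5) by (intro the_equality) auto

lemma sum_over_elements: "(\<Sum>i\<in>\<Union> (set \<pi>). f i) = (\<Sum>w<k. \<Sum>i\<in>\<pi> ! w. f i)"
proof -
  have "\<Union> (set \<pi>) = (\<Union>w\<in>{..<k}. \<pi> ! w)"
    using ordered_partition_facts(1) by (auto simp: set_conv_nth)
  moreover have "\<forall>w\<in>{..<k}. \<forall>b\<in>{..<k}. w \<noteq> b \<longrightarrow> \<pi> ! w \<inter> \<pi> ! b = {}"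
    using ordered_partition_facts(5) by blast
  ultimately show ?thesis
    using ordered_partition_facts(3) by (simp add: sum.UNION_disjoint)
qed

lemma double_count:
  assumes "finite A"
  shows "(\<Sum>i\<in>A. card {b. b < k \<and> P b \<and> Q b i}) = (\<Sum>b<k. if P b then card {i \<in> A. Q b i} else 0)"
proof -
  have "(\<Sum>i\<in>A. card {b. b < k \<and> P b \<and> Q b i}) = (\<Sum>i\<in>A. \<Sum>b<k. if P b \<and> Q b i then 1 else 0)"
    by (intro sum.cong refl) (simp add: sum.If_cases Int_def)
  also have "\<dots> = (\<Sum>b<k. \<Sum>i\<in>A. if P b \<and> Q b i then 1 else 0)"
    by (rule sum.swap)
  also have "\<dots> = (\<Sum>b<k. if P b then card {i \<in> A. Q b i} else 0)"
    using assms by (intro sum.cong refl) (simp add: sum.If_cases Int_def)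
  finally show ?thesis .
qed

text \<open>If \<open>h\<close> selects an element of every block, such as its opener or its closer, then counting
  selected elements amounts to counting blocks.\<close>

lemma sum_card_representatives:
  assumes h: "\<And>B. finite B \<Longrightarrow> B \<noteq> {} \<Longrightarrow> h B \<in> B"
  shows "(\<Sum>i\<in>\<Union> (set \<pi>). card {j \<in> h ` set \<pi>. Q j i \<and> P (block_index \<pi> j) (block_index \<pi> i)})
    = (\<Sum>w<k. \<Sum>b<k. if P b w then card {i \<in> \<pi> ! w. Q (h (\<pi> ! b)) i} else 0)"
proof -
  have hb: "h (\<pi> ! b) \<in> \<pi> ! b" if "b < k" for b
    by (rule h[OF ordered_partition_facts(3)[OF that] ordered_partition_facts(4)[OF that]])
  have inj: "inj_on (\<lambda>b. h (\<pi> ! b)) {..<k}"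
  proof (rule inj_onI)
    fix b b' assume "b \<in> {..<k}" "b' \<in> {..<k}" "h (\<pi> ! b) = h (\<pi> ! b')"
    then show "b = b'" using hb[of b] hb[of b'] by (intro ordered_partition_facts(5)) simp_all
  qed
  have "card {j \<in> h ` set \<pi>. Q j i \<and> P (block_index \<pi> j) (block_index \<pi> i)}
      = card {b. b < k \<and> P b w \<and> Q (h (\<pi> ! b)) i}" if w: "w < k" "i \<in> \<pi> ! w" for w i
  proof -
    have hset: "h ` set \<pi> = (\<lambda>b. h (\<pi> ! b)) ` {..<k}"
      using ordered_partition_facts(1) by (auto simp: set_conv_nth)
    have bi: "block_index \<pi> (h (\<pi> ! b)) = b" if "b < k" for b
      using block_index_eq[OF that hb[OF that]] .
    have "{j \<in> h ` set \<pi>. Q j i \<and> P (block_index \<pi> j) (block_index \<pi> i)}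
        = (\<lambda>b. h (\<pi> ! b)) ` {b. b < k \<and> P b w \<and> Q (h (\<pi> ! b)) i}"
      unfolding hset block_index_eq[OF w] by (auto simp: bi)
    then show ?thesis
      by (simp add: card_image inj_on_subset[OF inj] subset_iff)
  qed
  then show ?thesis
    by (simp add: sum_over_elements double_count ordered_partition_facts(3))
qed

lemmas sum_card_openers =
  sum_card_representatives[where h = Min, OF Min_in, folded openers_def]
lemmas sum_card_closers =
  sum_card_representatives[where h = Max, OF Max_in, folded closers_def]

lemma MAK_pairs: "MAK \<pi> = pair_sum mak_pair (map (\<lambda>B. (B, False)) \<pi>)"
proof -
  have "ros \<pi> = (\<Sum>w<k. \<Sum>b<k. if w < b then card {i \<in> \<pi> ! w. Min (\<pi> ! b) < i} else 0)"
    unfolding ros_def by (rule sum_card_openers)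
  moreover have "lcs \<pi> = (\<Sum>w<k. \<Sum>b<k. if b < w then card {i \<in> \<pi> ! w. Max (\<pi> ! b) < i} else 0)"
    unfolding lcs_def by (rule sum_card_closers)
  ultimately show ?thesis
    unfolding MAK_def pair_sum_nth
    by (simp add: sum_index_pairs ordered_partition_facts(1) mak_pair_def cong: if_cong)
qed

lemma MAK'_pairs:
  "MAK' \<pi> = pair_sum (\<lambda>B C. card {i \<in> B. i < Max C} + card {i \<in> C. i < Min B}) \<pi>"
proof -
  have "lob \<pi> = (\<Sum>w<k. \<Sum>b<k. if b < w then card {i \<in> \<pi> ! w. Min (\<pi> ! b) > i} else 0)"
    unfolding lob_def by (rule sum_card_openers)
  moreover have "rcb \<pi> = (\<Sum>w<k. \<Sum>b<k. if w < b then card {i \<in> \<pi> ! w. Max (\<pi> ! b) > i} else 0)"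
    unfolding rcb_def by (rule sum_card_closers)
  ultimately show ?thesis
    unfolding MAK'_def pair_sum_nth add.commute[of "lob \<pi>"]
    by (simp add: sum_index_pairs ordered_partition_facts(1) cong: if_cong)
qed

lemma lsb_pairs: "lsb \<pi> = pair_sum lsb_pair (map (\<lambda>B. (B, False)) \<pi>)"
proof -
  have "lsb \<pi> = (\<Sum>w<k. \<Sum>i\<in>\<pi> ! w. card {b. b < k \<and> b < w \<and> (Min (\<pi> ! b) < i \<and> Max (\<pi> ! b) > i)})"
    unfolding lsb_def sum_over_elements lsb_at_def
    by (intro sum.cong refl arg_cong[of _ _ card]) (auto simp: block_index_eq)
  also have "\<dots> = (\<Sum>w<k. \<Sum>b<k. if b < w then card {i \<in> \<pi> ! w. Min (\<pi> ! b) < i \<and> Max (\<pi> ! b) > i} else 0)"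
    by (simp add: double_count ordered_partition_facts(3))
  also have "\<dots> = (\<Sum>w<k. \<Sum>b<k. if w < b then card {i \<in> \<pi> ! b. Min (\<pi> ! w) < i \<and> Max (\<pi> ! w) > i} else 0)"
    by (rule sum.swap)
  finally show ?thesis
    by (simp add: pair_sum_nth ordered_partition_facts(1) lsb_pair_def cong: if_cong)
qed

end

lemma bMaj_rel_maj: "bMaj \<pi> = rel_maj block_gt 1 \<pi>"
proof -
  have "block_descents \<pi> = Suc ` {i. Suc i < length \<pi> \<and> block_gt (\<pi> ! i) (\<pi> ! Suc i)}"
  proof (rule set_eqI)
    fix i
    show "i \<in> block_descents \<pi> \<longleftrightarrow> i \<in> Suc ` {i. Suc i < length \<pi> \<and> block_gt (\<pi> ! i) (\<pi> ! Suc i)}"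
      by (cases i) (auto simp: block_descents_def)
  qed
  then show ?thesis unfolding bMaj_def rel_maj_nth by (simp add: sum.reindex)
qed

lemma rel_maj_map: "rel_maj R s (map f l) = rel_maj (\<lambda>x y. R (f x) (f y)) s l"
  by (induction "\<lambda>x y. R (f x) (f y)" s l rule: rel_maj.induct) auto

lemma pair_sum_map: "pair_sum g (map f l) = pair_sum (\<lambda>x y. g (f x) (f y)) l"
  by (induction l) (auto simp: comp_def)

lemma pair_sum_cong:
  "(\<And>x y. x \<in> set l \<Longrightarrow> y \<in> set l \<Longrightarrow> f x y = g x y) \<Longrightarrow> pair_sum f l = pair_sum g l"
  by (induction l) (auto intro!: arg_cong[of _ _ sum_list] map_cong)

section \<open>From marked partitions to ordered partitions\<close>

text \<open>An ordered partition of \<open>{1..n}\<close> is a marked one without active blocks.\<close>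

definition unmarked :: "nat set list \<Rightarrow> marked_block list" where
  "unmarked \<pi> = map (\<lambda>B. (B, False)) \<pi>"

lemma bij_betw_unmarked:
  "bij_betw unmarked (ordered_partitions n k) {l \<in> marked_partitions n. length l = k \<and> num_active l = 0}"
proof (rule bij_betw_byWitness[where f' = "map fst"])
  show "\<forall>\<pi>\<in>ordered_partitions n k. map fst (unmarked \<pi>) = \<pi>"
    by (simp add: unmarked_def comp_def)
  show "\<forall>l\<in>{l \<in> marked_partitions n. length l = k \<and> num_active l = 0}. unmarked (map fst l) = l"
    by (auto simp: unmarked_def comp_def filter_empty_conv intro!: map_idI)
  show "unmarked ` ordered_partitions n k \<subseteq> {l \<in> marked_partitions n. length l = k \<and> num_active l = 0}"
  proof (rule image_subsetI)
    fix \<pi> assume \<pi>: "\<pi> \<in> ordered_partitions n k"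
    have "\<pi> ! i \<inter> \<pi> ! j = {}" if "i < j" "j < k" for i j
      using \<pi> that by (simp add: ordered_partitions_def disjoint_family_on_def)
    then have "sorted_wrt (\<lambda>x y. fst x \<inter> fst y = {}) (unmarked \<pi>)"
      using ordered_partition_facts(1)[OF \<pi>]
      by (auto simp: unmarked_def sorted_wrt_map sorted_wrt_iff_nth_less)
    moreover have "(\<Union>x\<in>set (unmarked \<pi>). fst x) = {1..n}"
      using ordered_partition_facts(2)[OF \<pi>] by (simp add: unmarked_def)
    moreover have "\<forall>x\<in>set (unmarked \<pi>). fst x \<noteq> {} \<and> \<not> snd x" "length (unmarked \<pi>) = k"
      using \<pi> by (auto simp: unmarked_def ordered_partitions_def)
    ultimately show "unmarked \<pi> \<in> {l \<in> marked_partitions n. length l = k \<and> num_active l = 0}"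
      by (auto simp: marked_partitions_def filter_empty_conv)
  qed
  show "map fst ` {l \<in> marked_partitions n. length l = k \<and> num_active l = 0} \<subseteq> ordered_partitions n k"
  proof clarify
    fix l assume l: "l \<in> marked_partitions n" "k = length l"
    have d: "fst (l ! i) \<inter> fst (l ! j) = {}" if "i < j" "j < length l" for i j
      using l that by (simp add: marked_partitions_def sorted_wrt_iff_nth_less)
    have "fst (l ! i) \<inter> fst (l ! j) = {}" if "i < length l" "j < length l" "i \<noteq> j" for i j
      using that(3)
    proof (rule linorder_neqE_nat)
      assume "j < i"
      then show ?thesis using d[of j i] that by (simp add: Int_commute)
    qed (use d that in simp)
    then show "map fst l \<in> ordered_partitions n (length l)"
      using l by (auto simp: ordered_partitions_def marked_partitions_def disjoint_family_on_def)
  qed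
qed

text \<open>The involution \<open>i \<mapsto> n + 1 - i\<close>, applied to the elements of all blocks.  It exchanges openers
  and closers, hence \<open>MAK'\<close> and \<open>MAK\<close>, keeps \<open>lsb\<close>, and turns block descents into block
  ascents.\<close>

definition complement :: "nat \<Rightarrow> nat set list \<Rightarrow> nat set list" where
  "complement n \<pi> = map ((`) (\<lambda>i. Suc n - i)) \<pi>"

lemma complement_in:
  assumes "\<pi> \<in> ordered_partitions n k"
  shows "complement n \<pi> \<in> ordered_partitions n k" "complement n (complement n \<pi>) = \<pi>"
proof -
  note facts = ordered_partition_facts[OF assms]
  have sub: "B \<subseteq> {1..n}" if "B \<in> set \<pi>" for B
    using facts(2) that by auto
  have "(\<lambda>i. Suc n - i) ` (\<lambda>i. Suc n - i) ` B = B" if "B \<in> set \<pi>" for B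
    using sub[OF that] by (force simp: image_image)
  then show "complement n (complement n \<pi>) = \<pi>"
    by (auto simp: complement_def comp_def intro!: map_idI)
  have inj: "inj_on (\<lambda>i. Suc n - i) {1..n}"
    by (rule inj_onI) auto
  have "(\<lambda>i. Suc n - i) ` (\<pi> ! i) \<inter> (\<lambda>i. Suc n - i) ` (\<pi> ! j) = {}"
    if "i < k" "j < k" "i \<noteq> j" for i j
  proof -
    have "(\<lambda>i. Suc n - i) ` (\<pi> ! i \<inter> \<pi> ! j) = (\<lambda>i. Suc n - i) ` (\<pi> ! i) \<inter> (\<lambda>i. Suc n - i) ` (\<pi> ! j)"
      using sub that facts(1) by (intro inj_on_image_Int[OF inj]) auto
    moreover have "\<pi> ! i \<inter> \<pi> ! j = {}" using facts(5) that by blast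
    ultimately show ?thesis by simp
  qed
  moreover have "(\<lambda>i. Suc n - i) ` {1..n} = {1..n}"
  proof (rule endo_inj_surj[OF _ _ inj])
    show "(\<lambda>i. Suc n - i) ` {1..n} \<subseteq> {1..n}" by auto
  qed simp
  then have "(\<Union>B\<in>set \<pi>. (\<lambda>i. Suc n - i) ` B) = {1..n}"
    by (simp add: image_Union[symmetric] facts(2))
  ultimately show "complement n \<pi> \<in> ordered_partitions n k"
    using assms facts(1)
    by (auto simp: ordered_partitions_def complement_def disjoint_family_on_def)
qed

lemma bij_betw_complement: "bij_betw (complement n) (ordered_partitions n k) (ordered_partitions n k)"
  by (rule bij_betw_byWitness[where f' = "complement n"]) (auto simp: complement_in)

lemma complement_block:
  assumes "B \<subseteq> {1..n}" "B \<noteq> {}"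
  shows "Min ((\<lambda>i. Suc n - i) ` B) = Suc n - Max B" "Max ((\<lambda>i. Suc n - i) ` B) = Suc n - Min B"
    "1 \<le> Min B" "Max B \<le> n" "Min B \<le> n" "1 \<le> Max B"
    "card {i \<in> (\<lambda>i. Suc n - i) ` B. P i} = card {i \<in> B. P (Suc n - i)}"
proof -
  have fin: "finite B" using assms(1) finite_subset by auto
  note M = Min_in[OF fin assms(2)] Max_in[OF fin assms(2)]
  show "1 \<le> Min B" "Max B \<le> n" "Min B \<le> n" "1 \<le> Max B" using M assms(1) by auto
  show "Min ((\<lambda>i. Suc n - i) ` B) = Suc n - Max B"
    using fin M by (intro Min_eqI) (auto intro!: diff_le_mono2)
  show "Max ((\<lambda>i. Suc n - i) ` B) = Suc n - Min B"
    using fin M by (intro Max_eqI) (auto intro!: diff_le_mono2)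
  have "{i \<in> (\<lambda>i. Suc n - i) ` B. P i} = (\<lambda>i. Suc n - i) ` {i \<in> B. P (Suc n - i)}" by auto
  moreover have "inj_on (\<lambda>i. Suc n - i) {i \<in> B. P (Suc n - i)}"
  proof (rule inj_onI)
    fix i j assume "i \<in> {i \<in> B. P (Suc n - i)}" "j \<in> {i \<in> B. P (Suc n - i)}" "Suc n - i = Suc n - j"
    moreover from this have "i \<le> n" "j \<le> n" using assms(1) by auto
    ultimately show "i = j" by simp
  qed
  ultimately show "card {i \<in> (\<lambda>i. Suc n - i) ` B. P i} = card {i \<in> B. P (Suc n - i)}"
    by (simp add: card_image)
qed

lemma statistics_complement:
  assumes "\<pi> \<in> ordered_partitions n k"
  shows "MAK' \<pi> = pair_sum mak_pair (unmarked (complement n \<pi>))"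
    "lsb \<pi> = pair_sum lsb_pair (unmarked (complement n \<pi>))"
    "bMaj \<pi> = rel_maj block_asc 1 (unmarked (complement n \<pi>))"
proof -
  note facts = ordered_partition_facts[OF assms]
  have B: "B \<subseteq> {1..n}" "B \<noteq> {}" if "B \<in> set \<pi>" for B
    using that facts(1,4) Union_upper[OF that] unfolding facts(2) by (auto simp: in_set_conv_nth)
  have unm: "unmarked (complement n \<pi>) = map (\<lambda>B. ((\<lambda>i. Suc n - i) ` B, False)) \<pi>"
    by (simp add: unmarked_def complement_def comp_def)
  note cb = complement_block[OF B]
  have le: "i \<le> n" if "i \<in> B" "B \<in> set \<pi>" for i B using B[OF that(2)] that by auto
  have flip: "{i \<in> A. Suc n - y < Suc n - i} = {i \<in> A. i < y}" if "A \<in> set \<pi>" for A y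
  proof (rule Collect_cong, rule conj_cong)
    fix i assume "i \<in> A"
    then have "i \<le> n" using le that by blast
    then show "Suc n - y < Suc n - i \<longleftrightarrow> i < y" by arith
  qed simp
  have flip_both: "{i \<in> A. Suc n - y < Suc n - i \<and> Suc n - i < Suc n - z} = {i \<in> A. z < i \<and> i < y}"
    if "A \<in> set \<pi>" "z \<le> n" for A y z
  proof (rule Collect_cong, rule conj_cong)
    fix i assume "i \<in> A"
    then have "i \<le> n" using le that by blast
    then show "Suc n - y < Suc n - i \<and> Suc n - i < Suc n - z \<longleftrightarrow> z < i \<and> i < y"
      using that(2) by arith
  qed simp
  show "MAK' \<pi> = pair_sum mak_pair (unmarked (complement n \<pi>))"
    unfolding MAK'_pairs[OF assms] unm pair_sum_map
  proof (rule pair_sum_cong)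
    fix B C assume "B \<in> set \<pi>" "C \<in> set \<pi>"
    then show "card {i \<in> B. i < Max C} + card {i \<in> C. i < Min B}
       = mak_pair ((\<lambda>i. Suc n - i) ` B, False) ((\<lambda>i. Suc n - i) ` C, False)"
      by (simp add: mak_pair_def cb flip)
  qed
  show "lsb \<pi> = pair_sum lsb_pair (unmarked (complement n \<pi>))"
    unfolding lsb_pairs[OF assms] unm pair_sum_map
  proof (rule pair_sum_cong)
    fix B C assume "B \<in> set \<pi>" "C \<in> set \<pi>"
    then show "lsb_pair (B, False) (C, False)
       = lsb_pair ((\<lambda>i. Suc n - i) ` B, False) ((\<lambda>i. Suc n - i) ` C, False)"
      by (simp add: lsb_pair_def cb flip_both)
  qed
  show "bMaj \<pi> = rel_maj block_asc 1 (unmarked (complement n \<pi>))"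
    unfolding bMaj_rel_maj unm rel_maj_map
  proof (rule rel_maj_cong)
    fix i assume i: "Suc i < length \<pi>"
    then have mem: "\<pi> ! i \<in> set \<pi>" "\<pi> ! Suc i \<in> set \<pi>" by auto
    have "Suc n - x < Suc n - y \<longleftrightarrow> y < x" if "x \<le> n" "y \<le> n" for x y
      using that by arith
    from this[OF cb(5)[OF mem(1)] cb(4)[OF mem(2)]] mem
    show "block_gt (\<pi> ! i) (\<pi> ! Suc i) \<longleftrightarrow>
        block_asc ((\<lambda>i. Suc n - i) ` (\<pi> ! i), False) ((\<lambda>i. Suc n - i) ` (\<pi> ! Suc i), False)"
      by (simp add: block_gt_def block_asc_def cb(1,2))
  qed simp
qed

section \<open>The distribution of the statistics\<close>

lemma pq_distribution:
  fixes p q :: "'a::comm_semiring_1"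
  assumes "k \<le> n" and R: "admissible R"
    and h: "bij_betw h (ordered_partitions n k) (ordered_partitions n k)"
    and stats: "\<And>\<pi>. \<pi> \<in> ordered_partitions n k \<Longrightarrow>
      stat \<pi> = pair_sum mak_pair (unmarked (h \<pi>)) \<and>
      lsb \<pi> = pair_sum lsb_pair (unmarked (h \<pi>)) \<and>
      bMaj \<pi> = rel_maj R 1 (unmarked (h \<pi>))"
  shows "(\<Sum>\<pi>\<in>ordered_partitions n k. p ^ (stat \<pi> + bMaj \<pi>) * q ^ cmajLSB \<pi>)
    = q ^ (k choose 2) * pq_fact p q k * pq_Stirling p q n k"
proof -
  have "(\<Sum>\<pi>\<in>ordered_partitions n k. p ^ (stat \<pi> + bMaj \<pi>) * q ^ cmajLSB \<pi>)
      = (\<Sum>\<pi>\<in>ordered_partitions n k. q ^ (k choose 2) * weight R p q (unmarked (h \<pi>)))"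
  proof (rule sum.cong)
    fix \<pi> assume \<pi>: "\<pi> \<in> ordered_partitions n k"
    have "length \<pi> = k" "length (unmarked (h \<pi>)) = k"
      using \<pi> bij_betwE[OF h] by (auto simp: ordered_partitions_def unmarked_def)
    then show "p ^ (stat \<pi> + bMaj \<pi>) * q ^ cmajLSB \<pi> = q ^ (k choose 2) * weight R p q (unmarked (h \<pi>))"
      using stats[OF \<pi>] unfolding weight_def cmajLSB_def cbMaj_def
      by (simp add: power_add mult.commute mult.left_commute)
  qed simp
  also have "\<dots> = q ^ (k choose 2) * (\<Sum>\<pi>\<in>ordered_partitions n k. weight R p q (unmarked \<pi>))"
    unfolding sum_distrib_left[symmetric]
    using sum.reindex_bij_betw[OF h, of "\<lambda>\<pi>. weight R p q (unmarked \<pi>)"] by simp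
  also have "(\<Sum>\<pi>\<in>ordered_partitions n k. weight R p q (unmarked \<pi>))
      = (\<Sum>l | l \<in> marked_partitions n \<and> length l = k \<and> num_active l = 0. weight R p q l)"
    by (rule sum.reindex_bij_betw[OF bij_betw_unmarked])
  also have "\<dots> = pq_fact p q k * pq_Stirling p q n k"
    by (rule sum_weight_unmarked[OF R \<open>k \<le> n\<close>])
  finally show ?thesis by (simp add: mult.assoc)
qed

lemma MAK_distribution:
  fixes p q :: "'a::comm_semiring_1"
  assumes "k \<le> n"
  shows "(\<Sum>\<pi>\<in>ordered_partitions n k. p ^ (MAK \<pi> + bMaj \<pi>) * q ^ cmajLSB \<pi>)
    = q ^ (k choose 2) * pq_fact p q k * pq_Stirling p q n k"
proof (rule pq_distribution[OF assms admissible_block_desc, of id])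
  fix \<pi> assume "\<pi> \<in> ordered_partitions n k"
  then show "MAK \<pi> = pair_sum mak_pair (unmarked (id \<pi>)) \<and>
      lsb \<pi> = pair_sum lsb_pair (unmarked (id \<pi>)) \<and>
      bMaj \<pi> = rel_maj block_desc 1 (unmarked (id \<pi>))"
    by (simp add: MAK_pairs lsb_pairs bMaj_rel_maj unmarked_def rel_maj_map block_desc_def block_gt_def[abs_def])
qed simp

lemma MAK'_distribution:
  fixes p q :: "'a::comm_semiring_1"
  assumes "k \<le> n"
  shows "(\<Sum>\<pi>\<in>ordered_partitions n k. p ^ (MAK' \<pi> + bMaj \<pi>) * q ^ cmajLSB \<pi>)
    = q ^ (k choose 2) * pq_fact p q k * pq_Stirling p q n k"
  using statistics_complement
  by (intro pq_distribution[OF assms admissible_block_asc bij_betw_complement]) blast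

lemma pq_Stirling_one_left: "q ^ (k choose 2) * pq_Stirling 1 q n k = q_Stirling q n k"
  by (simp add: q_Stirling_def pq_Stirling_red red_Stirling_commute[of 1])

theorem theorem3p4:
  fixes n k :: nat and p q :: "'a::comm_ring_1"
  assumes "1 \<le> k" and "k \<le> n"
  shows "(\<forall>MAG \<in> {MAK, MAK'}.
            (\<Sum>\<pi>\<in>ordered_partitions n k. p ^ (MAG \<pi> + bMaj \<pi>) * q ^ cmajLSB \<pi>)
              = q ^ (k choose 2) * pq_fact p q k * pq_Stirling p q n k)
       \<and> Euler_Mahonian n k (\<lambda>\<pi>. MAK \<pi> + bMaj \<pi>)
       \<and> Euler_Mahonian n k (\<lambda>\<pi>. MAK' \<pi> + bMaj \<pi>)
       \<and> Euler_Mahonian n k cmajLSB"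
proof (intro conjI)
  show "\<forall>MAG \<in> {MAK, MAK'}.
      (\<Sum>\<pi>\<in>ordered_partitions n k. p ^ (MAG \<pi> + bMaj \<pi>) * q ^ cmajLSB \<pi>)
        = q ^ (k choose 2) * pq_fact p q k * pq_Stirling p q n k"
    using MAK_distribution[OF assms(2), of p q] MAK'_distribution[OF assms(2), of p q] by simp
  let ?X = "[:0, 1:] :: int poly"
  show "Euler_Mahonian n k (\<lambda>\<pi>. MAK \<pi> + bMaj \<pi>)"
    using MAK_distribution[OF assms(2), of ?X 1]
    by (simp add: Euler_Mahonian_def pq_fact_one_right q_Stirling_def)
  show "Euler_Mahonian n k (\<lambda>\<pi>. MAK' \<pi> + bMaj \<pi>)"
    using MAK'_distribution[OF assms(2), of ?X 1]
    by (simp add: Euler_Mahonian_def pq_fact_one_right q_Stirling_def)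
  have "pq_fact 1 ?X k = q_fact ?X k"
    by (metis pq_fact_commute pq_fact_one_right)
  then show "Euler_Mahonian n k cmajLSB"
    using MAK_distribution[OF assms(2), of 1 ?X] pq_Stirling_one_left[of ?X k n]
    by (simp add: Euler_Mahonian_def mult.assoc mult.left_commute)
qed

end
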